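(* Let $\Sigma_1$ and $\Sigma_2$ be entire spacelike hypersurfaces in $\mathbb R^{n,1}$. Suppose that $\Sigma_1$ has mean curvature bounded below by $H_1>0$, that $\Sigma_2$ has mean curvature bounded above by $H_2$, and that $H_1\ge H_2$. Suppose also that $\Sigma_2\subset\mathcal D(\Sigma_1)$. Then $\Sigma_1\subset J^-(\Sigma_2)$.
   Context: Minkowski space $\mathbb R^{n,1}$ ($n\ge 1$) is $\mathbb R^{n+1}$ with $\langle\cdot,\cdot\rangle=dx_1^2+\dots+dx_n^2-dx_{n+1}^2$. A vector $v$ is spacelike, timelike or null if $\langle v,v\rangle$ is positive, negative or zero; future-directed means positive last coordinate. $J^-(X)$ is the set of points $p-v$ with $p\in X$ and $v$ zero or a future-directed timelike or null vector. A spacelike hypersurface is a smooth connected hypersurface on which the induced metric is Riemannian; it is entire if it is the graph $\{x_{n+1}=f(x_1,\dots,x_n)\}$ of a function $f:\mathbb R^n\to\mathbb R$. The mean curvature is $\frac1n\mathrm{tr}(d\nu)$, where $\nu$ is the future-directed unit normal (so the future unit hyperboloid has mean curvature $1$). A causal curve is a $C^0$ curve each pair of points of which is timelike- or null-separated; it is inextendable if it is globally the graph $\{(\gamma(t),t)\}$ of a $1$-Lipschitz function $\gamma:\mathbb R\to\mathbb R^n$. The domain of dependence $\mathcal D(\Sigma)$ is the set of points $p$ such that every inextendable causal curve through $p$ meets $\Sigma$. *)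

theory Defs
  imports "HOL-Analysis.Analysis"
begin

text \<open>The dimension is \<open>n = CARD('n) \<ge> 1\<close>; the second component of a point is its
  coordinate \<open>x\<^sub>n\<^sub>+\<^sub>1\<close>.\<close>

type_synonym 'n minkowski = "(real ^ 'n) \<times> real"

definition mink :: "'n::finite minkowski \<Rightarrow> 'n minkowski \<Rightarrow> real" where
  "mink v w = fst v \<bullet> fst w - snd v * snd w"

definition future_directed :: "'n::finite minkowski \<Rightarrow> bool" where
  "future_directed v \<longleftrightarrow> snd v > 0"

definition timelike :: "'n::finite minkowski \<Rightarrow> bool" where
  "timelike v \<longleftrightarrow> mink v v < 0"

definition null :: "'n::finite minkowski \<Rightarrow> bool" where
  "null v \<longleftrightarrow> mink v v = 0"

definition causal_past :: "'n::finite minkowski set \<Rightarrow> 'n minkowski set" where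
  "causal_past X =
     {p - v | p v. p \<in> X \<and> (v = 0 \<or> future_directed v \<and> (timelike v \<or> null v))}"

text \<open>Both definitions are meant for open domains, where the Frechet derivative is unique.\<close>

primrec Ck_on :: "nat \<Rightarrow> 'a::real_normed_vector set \<Rightarrow> ('a \<Rightarrow> 'b::real_normed_vector) \<Rightarrow> bool" where
  "Ck_on 0 U f \<longleftrightarrow> continuous_on U f"
| "Ck_on (Suc k) U f \<longleftrightarrow>
     (\<forall>x\<in>U. f differentiable (at x)) \<and> (\<forall>v. Ck_on k U (\<lambda>x. frechet_derivative f (at x) v))"

definition smooth_on :: "'a::real_normed_vector set \<Rightarrow> ('a \<Rightarrow> 'b::real_normed_vector) \<Rightarrow> bool" where
  "smooth_on U f \<longleftrightarrow> (\<forall>k. Ck_on k U f)"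

text \<open>Embedded hypersurfaces, given locally as regular zero sets.\<close>

definition smooth_hypersurface :: "'a::euclidean_space set \<Rightarrow> bool" where
  "smooth_hypersurface S \<longleftrightarrow>
     (\<forall>p\<in>S. \<exists>U (\<phi> :: 'a \<Rightarrow> real). open U \<and> p \<in> U \<and> smooth_on U \<phi> \<and>
        (\<forall>q\<in>U. \<exists>v. frechet_derivative \<phi> (at q) v \<noteq> 0) \<and>
        S \<inter> U = {q \<in> U. \<phi> q = 0})"

text \<open>Velocity vectors at \<open>p\<close> of smooth curves lying in \<open>S\<close>.\<close>

definition tangent_space :: "'a::euclidean_space set \<Rightarrow> 'a \<Rightarrow> 'a set" where
  "tangent_space S p =
     {v. \<exists>(c :: real \<Rightarrow> 'a) e. e > 0 \<and> smooth_on {-e<..<e} c \<and> c ` {-e<..<e} \<subseteq> S \<and>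
           c 0 = p \<and> (c has_vector_derivative v) (at 0)}"

definition spacelike_hypersurface :: "'n::finite minkowski set \<Rightarrow> bool" where
  "spacelike_hypersurface S \<longleftrightarrow> smooth_hypersurface S \<and> connected S \<and>
     (\<forall>p\<in>S. \<forall>v\<in>tangent_space S p. v \<noteq> 0 \<longrightarrow> mink v v > 0)"

definition entire :: "'n::finite minkowski set \<Rightarrow> bool" where
  "entire S \<longleftrightarrow> (\<exists>f :: real ^ 'n \<Rightarrow> real. S = {(x, f x) | x. True})"

definition unit_normal :: "'n::finite minkowski set \<Rightarrow> 'n minkowski \<Rightarrow> 'n minkowski" where
  "unit_normal S p =
     (THE \<nu>. (\<forall>v\<in>tangent_space S p. mink \<nu> v = 0) \<and> mink \<nu> \<nu> = -1 \<and> future_directed \<nu>)"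

text \<open>Trace of an endomorphism \<open>A\<close> of the subspace \<open>T\<close>, in an arbitrarily chosen basis of \<open>T\<close>
  (it does not depend on this choice).\<close>

definition trace_on :: "'a::euclidean_space set \<Rightarrow> ('a \<Rightarrow> 'a) \<Rightarrow> real" where
  "trace_on T A =
     (let B = (SOME B. independent B \<and> span B = T) in \<Sum>b\<in>B. representation B (A b) b)"

text \<open>The differential \<open>d\<nu>\<close> is the derivative of \<open>\<nu>\<close> along \<open>S\<close>. A derivative within \<open>S\<close> is
  determined only on the tangent space of \<open>S\<close>, but only its values there enter the trace.\<close>

definition mean_curvature :: "'n::finite minkowski set \<Rightarrow> 'n minkowski \<Rightarrow> real" where
  "mean_curvature S p =
     1 / real CARD('n) *
       trace_on (tangent_space S p) (frechet_derivative (unit_normal S) (at p within S))"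

text \<open>The graph of a 1-Lipschitz map is automatically a continuous curve any two points of which
  are timelike- or null-separated.\<close>

definition inextendable_causal_curve :: "'n::finite minkowski set \<Rightarrow> bool" where
  "inextendable_causal_curve C \<longleftrightarrow>
     (\<exists>\<gamma> :: real \<Rightarrow> real ^ 'n. 1-lipschitz_on UNIV \<gamma> \<and> C = {(\<gamma> t, t) | t. True})"

definition domain_of_dependence :: "'n::finite minkowski set \<Rightarrow> 'n minkowski set" where
  "domain_of_dependence S =
     {p. \<forall>C. inextendable_causal_curve C \<and> p \<in> C \<longrightarrow> C \<inter> S \<noteq> {}}"

end

theory Submission
  imports Defs
begin

text \<open>
Write \<open>\<Sigma>\<^sub>i\<close> as the graph of \<open>f\<^sub>i\<close>. The claim is \<open>f\<^sub>1 \<le> f\<^sub>2\<close>. Otherwise there are \<open>q \<in> \<Sigma>\<^sub>2\<close> and \<open>p \<in> \<Sigma>\<^sub>1\<close> with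
\<open>p - q\<close> future-directed timelike, and the idea is to look at the largest proper time \<open>\<tau>\<close> between such
points. If it were attained at \<open>q, p\<close>, the segment from \<open>q\<close> to \<open>p\<close> would be orthogonal to both
hypersurfaces. Moving \<open>q\<close> along an orthonormal frame and \<open>p\<close> along \<open>\<mu>\<close> times the same frame, the second
variation of the squared distance would give \<open>\<tau> (\<mu>\<^sup>2 H\<^sub>1 - H\<^sub>2) \<le> (\<mu> - 1)\<^sup>2\<close>, which is false for \<open>\<mu>\<close> slightly
larger than \<open>1\<close> because \<open>H\<^sub>1 \<ge> H\<^sub>2\<close> and \<open>H\<^sub>1 > 0\<close>.

Two points need care. First, \<open>\<tau>\<close> must be bounded. For fixed \<open>q\<close> in the domain of dependence of \<open>\<Sigma>\<^sub>1\<close> the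
part of \<open>\<Sigma>\<^sub>1\<close> in the causal future of \<open>q\<close> is compact (\<open>bounded_future_part\<close>), so the distance from \<open>q\<close> is
attained, and the second variation with \<open>q\<close> held fixed bounds it by \<open>1 / H\<^sub>1\<close> (\<open>focal_bound\<close>).

Second, the supremum over all \<open>q \<in> \<Sigma>\<^sub>2\<close> may fail to be attained, and the hypersurfaces need not be
controlled at infinity. So the squared distance is penalised by a small multiple \<open>\<epsilon>\<close> of the squared
displacement of \<open>p\<close> and \<open>q\<close> from a pair \<open>p\<^sub>0, q\<^sub>0\<close> that nearly attains the supremum. The displacement is
measured in the Euclidean metric of the observer with velocity \<open>N\<close> proportional to \<open>p\<^sub>0 - q\<^sub>0\<close>. A maximum
then exists by compactness, and at the maximum \<open>p - q\<close> and both normals are close to \<open>N\<close> in that metric.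
All error terms are therefore controlled by \<open>\<epsilon>\<close> and the size of the displacement alone, uniformly in
the (noncompact) set of possible directions \<open>N\<close>, and the contradiction above survives. As the two
normals now differ slightly, the frame at \<open>p\<close> is obtained from the frame at \<open>q\<close> by the boost between the
normals; the resulting error has a favourable sign (\<open>boost_expands\<close>). The argument is carried out in
\<open>separation_maximum\<close>, \<open>traced_second_variation\<close> and \<open>comparison_graphs\<close>.

The rest connects this with the definitions. The function \<open>f\<^sub>i\<close> is smooth by the implicit function
theorem, as a defining function of the hypersurface cannot have a vanishing vertical derivative: else
there would be a curve with vertical velocity in it. The mean curvature is the normalised trace of the
second fundamental form over any orthonormal frame (\<open>trace_on_frame\<close>), and the second fundamental form is
read off from accelerations of curves (\<open>second_fundamental_form\<close>).
\<close>

section \<open>Calculus of \<open>C\<^sup>k\<close> functions and implicit functions\<close>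

lemma Ck_on_cong_imp:
  assumes "open U" "\<And>x. x \<in> U \<Longrightarrow> f x = g x" "Ck_on k U f"
  shows "Ck_on k U g"
  using assms(2,3)
proof (induction k arbitrary: f g)
  case 0
  then show ?case by (metis Ck_on.simps(1) continuous_on_cong)
next
  case (Suc k)
  have d: "(g has_derivative frechet_derivative f (at x)) (at x)" if "x \<in> U" for x
  proof (rule has_derivative_transform_within_open[OF _ \<open>open U\<close> that])
    show "(f has_derivative frechet_derivative f (at x)) (at x)"
      using Suc.prems(2) that by (simp add: frechet_derivative_works[symmetric])
  qed (use Suc.prems in auto)
  have "Ck_on k U (\<lambda>x. frechet_derivative g (at x) v)" for v
  proof (rule Suc.IH)
    show "Ck_on k U (\<lambda>x. frechet_derivative f (at x) v)"
      using Suc.prems by simp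
  qed (simp add: frechet_derivative_at[OF d, symmetric])
  then show ?case
    using d by (auto simp: differentiable_def)
qed

text \<open>Any family of derivatives that is known on the open set serves in place of the chosen
  \<open>frechet_derivative\<close>; this is how all closure properties below enter their induction.\<close>

lemma Ck_on_SucI:
  assumes "\<And>x. x \<in> U \<Longrightarrow> (f has_derivative f' x) (at x)"
    and "\<And>v. Ck_on k U (\<lambda>x. f' x v)" and "open U"
  shows "Ck_on (Suc k) U f"
proof -
  have "Ck_on k U (\<lambda>x. frechet_derivative f (at x) v)" for v
    by (rule Ck_on_cong_imp[OF assms(3) _ assms(2)[of v]])
      (simp add: frechet_derivative_at[OF assms(1), symmetric])
  then show ?thesis
    using assms(1) by (auto simp: differentiable_def)
qed

lemma Ck_on_SucD:
  assumes "Ck_on (Suc k) U f"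
  shows "Ck_on k U f"
  using assms
proof (induction k arbitrary: f)
  case 0
  then show ?case
    by (auto intro!: continuous_at_imp_continuous_on differentiable_imp_continuous_within)
next
  case (Suc k)
  then show ?case by (metis Ck_on.simps(2))
qed

lemma Ck_on_has_derivative:
  assumes "Ck_on (Suc k) U f" "x \<in> U"
  shows "(f has_derivative frechet_derivative f (at x)) (at x)"
  using assms by (auto simp: frechet_derivative_works[symmetric])

lemma Ck_on_subset: "Ck_on k U f \<Longrightarrow> V \<subseteq> U \<Longrightarrow> Ck_on k V f"
  by (induction k arbitrary: f) (auto intro: continuous_on_subset)

lemma Ck_on_const: "Ck_on k U (\<lambda>x. c)"
  by (induction k arbitrary: c) (auto simp: frechet_derivative_const)

lemma Ck_on_bounded_linear:
  assumes "bounded_linear f"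
  shows "Ck_on k U f"
proof (cases k)
  case 0
  then show ?thesis by (simp add: assms linear_continuous_on)
next
  case (Suc j)
  have "(f has_derivative f) (at x)" for x
    by (simp add: assms bounded_linear_imp_has_derivative)
  then have "frechet_derivative f (at x) = f" for x
    using frechet_derivative_at by metis
  then show ?thesis
    using Suc \<open>\<And>x. (f has_derivative f) (at x)\<close> by (auto simp: differentiable_def Ck_on_const)
qed

lemma Ck_on_add:
  assumes "open U" "Ck_on k U f" "Ck_on k U g"
  shows "Ck_on k U (\<lambda>x. f x + g x)"
  using assms(2,3)
proof (induction k arbitrary: f g)
  case 0
  then show ?case by (auto intro: continuous_intros)
next
  case (Suc k)
  show ?case
    by (rule Ck_on_SucI[OF has_derivative_add[OF Ck_on_has_derivative Ck_on_has_derivative]])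
      (use Suc \<open>open U\<close> in auto)
qed

lemma Ck_on_bilinear:
  assumes "bounded_bilinear pr" "open U" "Ck_on k U f" "Ck_on k U g"
  shows "Ck_on k U (\<lambda>x. pr (f x) (g x))"
  using assms(3,4)
proof (induction k arbitrary: f g)
  case 0
  then show ?case by (auto intro: bounded_bilinear.continuous_on[OF assms(1)])
next
  case (Suc k)
  show ?case
  proof (rule Ck_on_SucI[OF bounded_bilinear.FDERIV[OF assms(1) Ck_on_has_derivative Ck_on_has_derivative]])
    fix v
    show "Ck_on k U (\<lambda>x. pr (f x) (frechet_derivative g (at x) v) + pr (frechet_derivative f (at x) v) (g x))"
      using Suc.prems Ck_on_SucD[OF Suc.prems(1)] Ck_on_SucD[OF Suc.prems(2)]
      by (intro Ck_on_add assms(2) Suc.IH) auto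
  qed (use Suc \<open>open U\<close> in auto)
qed

lemma Ck_on_Pair:
  assumes "open U" "Ck_on k U f" "Ck_on k U g"
  shows "Ck_on k U (\<lambda>x. (f x, g x))"
  using assms(2,3)
proof (induction k arbitrary: f g)
  case 0
  then show ?case by (auto intro: continuous_intros)
next
  case (Suc k)
  show ?case
    by (rule Ck_on_SucI[OF has_derivative_Pair[OF Ck_on_has_derivative Ck_on_has_derivative]])
      (use Suc \<open>open U\<close> in auto)
qed

lemma Ck_on_sum:
  assumes "open U" "\<And>i. i \<in> I \<Longrightarrow> Ck_on k U (f i)"
  shows "Ck_on k U (\<lambda>x. \<Sum>i\<in>I. f i x)"
  using assms(2)
  by (induction I rule: infinite_finite_induct) (auto simp: Ck_on_const intro!: Ck_on_add assms(1))

lemma Ck_on_inverse: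
  fixes f :: "'a::real_normed_vector \<Rightarrow> real"
  assumes "open U" "Ck_on k U f" "\<And>x. x \<in> U \<Longrightarrow> f x \<noteq> 0"
  shows "Ck_on k U (\<lambda>x. inverse (f x))"
  using assms(2)
proof (induction k)
  case 0
  then show ?case using assms(3) by (auto intro: continuous_intros)
next
  case (Suc k)
  have inv: "Ck_on k U (\<lambda>x. inverse (f x))"
    using Suc Ck_on_SucD by blast
  show ?case
  proof (rule Ck_on_SucI[OF Deriv.has_derivative_inverse[OF _ Ck_on_has_derivative[OF Suc.prems]]])
    fix v
    have "Ck_on k U (\<lambda>x. frechet_derivative f (at x) v)"
      using Suc.prems by simp
    then have "Ck_on k U (\<lambda>x. (-1) * (inverse (f x) * frechet_derivative f (at x) v * inverse (f x)))"
      by (intro Ck_on_bilinear[OF bounded_bilinear_mult] inv Ck_on_const assms(1))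
    then show "Ck_on k U (\<lambda>x. - (inverse (f x) * frechet_derivative f (at x) v * inverse (f x)))"
      by simp
  qed (use assms in auto)
qed

lemma Ck_on_compose:
  fixes f :: "'a::real_normed_vector \<Rightarrow> 'b::euclidean_space"
  assumes "open U" "open V" "Ck_on k V f" "f ` V \<subseteq> U" "Ck_on k U g"
  shows "Ck_on k V (\<lambda>x. g (f x))"
  using assms(3,5)
proof (induction k arbitrary: g)
  case 0
  then show ?case
    using assms(4) by (auto intro: continuous_on_compose2)
next
  case (Suc k)
  have fx: "f x \<in> U" if "x \<in> V" for x using that assms(4) by auto
  have d: "((\<lambda>x. g (f x)) has_derivative
      (\<lambda>h. frechet_derivative g (at (f x)) (frechet_derivative f (at x) h))) (at x)" if "x \<in> V" for x
    using diff_chain_at[OF Ck_on_has_derivative[OF Suc.prems(1) that] Ck_on_has_derivative[OF Suc.prems(2) fx[OF that]]]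
    by (simp add: o_def)
  \<comment> \<open>Expanding in a basis reduces the derivative of a composition to products of compositions
     with the directional derivatives of the outer function along fixed vectors.\<close>
  have expand: "frechet_derivative g (at (f x)) (frechet_derivative f (at x) v) =
      (\<Sum>b\<in>Basis. (frechet_derivative f (at x) v \<bullet> b) *\<^sub>R frechet_derivative g (at (f x)) b)"
    if "x \<in> V" for x v
  proof -
    have "linear (frechet_derivative g (at (f x)))"
      using Ck_on_has_derivative[OF Suc.prems(2) fx[OF that]] has_derivative_linear by blast
    then show ?thesis
      by (subst euclidean_representation[of "frechet_derivative f (at x) v", symmetric])
        (simp only: linear_sum linear_scale)
  qed
  have "Ck_on k V (\<lambda>x. \<Sum>b\<in>Basis. (frechet_derivative f (at x) v \<bullet> b) *\<^sub>R frechet_derivative g (at (f x)) b)" for v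
    using Suc.prems Ck_on_SucD[OF Suc.prems(1)]
    by (intro Ck_on_sum Ck_on_bilinear[OF bounded_bilinear_scaleR] Ck_on_bilinear[OF bounded_bilinear_inner]
        assms(1,2) Suc.IH Ck_on_const) auto
  then have "Ck_on k V (\<lambda>x. frechet_derivative g (at (f x)) (frechet_derivative f (at x) v))" for v
    by (rule Ck_on_cong_imp[OF assms(2), rotated]) (simp add: expand)
  then show ?case
    by (intro Ck_on_SucI[OF d _ assms(2)])
qed

lemma Ck_on_local:
  assumes "\<And>x. x \<in> U \<Longrightarrow> \<exists>V. open V \<and> x \<in> V \<and> Ck_on k V f"
  shows "Ck_on k U f"
  using assms
proof (induction k arbitrary: f)
  case 0
  then show ?case
    unfolding Ck_on.simps
    by (intro continuous_at_imp_continuous_on ballI) (metis continuous_on_eq_continuous_at)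
next
  case (Suc k)
  have "f differentiable (at x)" if "x \<in> U" for x
    using Suc.prems[OF that] by auto
  moreover have "Ck_on k U (\<lambda>x. frechet_derivative f (at x) v)" for v
  proof (rule Suc.IH)
    fix x assume "x \<in> U"
    from Suc.prems[OF this] show "\<exists>V. open V \<and> x \<in> V \<and> Ck_on k V (\<lambda>x. frechet_derivative f (at x) v)"
      by auto
  qed
  ultimately show ?case by simp
qed

lemma smooth_on_has_derivative:
  assumes "smooth_on U f" "x \<in> U"
  shows "(f has_derivative frechet_derivative f (at x)) (at x)"
  using assms Ck_on_has_derivative unfolding smooth_on_def by blast

lemma smooth_on_derivative:
  "smooth_on U f \<Longrightarrow> smooth_on U (\<lambda>x. frechet_derivative f (at x) v)"
  unfolding smooth_on_def by (metis Ck_on.simps(2))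

text \<open>The inverse function theorem makes the implicit function differentiable; as its derivative is
  a rational expression in first derivatives of \<open>\<psi>\<close> along the graph, each \<open>C\<^sup>k\<close> bound on the
  implicit function yields the next one.\<close>

lemma implicit_function_smooth:
  fixes \<psi> :: "'a::euclidean_space \<times> real \<Rightarrow> real"
  assumes U: "open U" "(x0, y0) \<in> U" and sm: "smooth_on U \<psi>" and z: "\<psi> (x0, y0) = 0"
    and nz: "frechet_derivative \<psi> (at (x0, y0)) (0, 1) \<noteq> 0"
  obtains V g where "open V" "x0 \<in> V" "smooth_on V g" "g x0 = y0"
    "\<And>x. x \<in> V \<Longrightarrow> (x, g x) \<in> U \<and> \<psi> (x, g x) = 0"
proof -
  define d where "d z = frechet_derivative \<psi> (at z)" for z
  have dpsi: "(\<psi> has_derivative d z) (at z)" if "z \<in> U" for z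
    using smooth_on_has_derivative[OF sm that] by (simp add: d_def)
  have lin: "bounded_linear (d z)" if "z \<in> U" for z
    using dpsi[OF that] has_derivative_bounded_linear by blast
  define F where "F z = (fst z, \<psi> z)" for z
  define F' where "F' z = Blinfun (\<lambda>h. (fst h, d z h))" for z
  have F'_apply: "blinfun_apply (F' z) = (\<lambda>h. (fst h, d z h))" if "z \<in> U" for z
    unfolding F'_def
    by (rule bounded_linear_Blinfun_apply)
      (intro bounded_linear_Pair bounded_linear_fst lin that)
  have derF: "(F has_derivative blinfun_apply (F' z)) (at z)" if "z \<in> U" for z
    unfolding F'_apply[OF that] F_def
    by (intro has_derivative_Pair dpsi that has_derivative_fst has_derivative_ident)
  have contF: "continuous_on U F'"
  proof (rule continuous_on_blinfun_componentwise)
    fix i :: "'a \<times> real"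
    have "Ck_on 0 U (\<lambda>z. d z i)"
      using smooth_on_derivative[OF sm, of i] unfolding smooth_on_def d_def by blast
    then have "continuous_on U (\<lambda>z. (fst i, d z i))"
      by (intro continuous_intros) auto
    then show "continuous_on U (\<lambda>z. blinfun_apply (F' z) i)"
      by (rule continuous_on_eq) (simp add: F'_apply)
  qed
  let ?z = "(x0, y0)"
  let ?b = "d ?z (0, 1)"
  define I where "I = (\<lambda>w::'a \<times> real. (fst w, (snd w - d ?z (fst w, 0)) / ?b))"
  have linI: "bounded_linear I"
  proof -
    have "bounded_linear (\<lambda>w::'a \<times> real. d ?z (fst w, 0))"
      by (intro bounded_linear_compose[OF lin[OF U(2)]] bounded_linear_Pair bounded_linear_fst bounded_linear_zero)
    then show ?thesis
      unfolding I_def divide_inverse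
      by (intro bounded_linear_Pair bounded_linear_fst bounded_linear_mult_const bounded_linear_sub bounded_linear_snd)
  qed
  have split: "d z (h, t) = d z (h, 0) + t * d z (0, 1)" if "z \<in> U" for z h t
  proof -
    interpret bounded_linear "d z" by (rule lin[OF that])
    have "d z (h, t) = d z ((h, 0) + t *\<^sub>R (0, 1))" by simp
    then show ?thesis by (simp only: add scaleR real_scaleR_def)
  qed
  have "Blinfun I o\<^sub>L F' ?z = id_blinfun"
  proof (rule blinfun_eqI)
    fix w :: "'a \<times> real"
    show "blinfun_apply (Blinfun I o\<^sub>L F' ?z) w = blinfun_apply id_blinfun w"
      using split[OF U(2), of "fst w" "snd w"] nz
      unfolding blinfun_apply_blinfun_compose bounded_linear_Blinfun_apply[OF linI] F'_apply[OF U(2)]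
      by (simp add: I_def d_def[symmetric])
  qed
  from inverse_function_theorem[OF U(1) derF contF U(2) this]
  obtain U' V G G' where U': "open U'" "U' \<subseteq> U" "?z \<in> U'" and V: "open V" "F ?z \<in> V"
    and hom: "homeomorphism U' V F G"
    and derG: "\<And>y. y \<in> V \<Longrightarrow> (G has_derivative (G' y)) (at y)"
    and bij: "\<And>y. y \<in> V \<Longrightarrow> bij (blinfun_apply (F' (G y)))"
    by metis
  define V0 where "V0 = (\<lambda>x. (x, 0::real)) -` V"
  define g where "g x = snd (G (x, 0))" for x
  have V0: "open V0" unfolding V0_def
    by (intro continuous_open_vimage V(1) continuous_intros)
  have x0: "x0 \<in> V0" using V(2) z by (simp add: V0_def F_def)
  have GU: "G w \<in> U'" "F (G w) = w" if "w \<in> V" for w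
    using hom that by (auto simp: homeomorphism_def)
  have Gx: "G (x, 0) = (x, g x)" "\<psi> (x, g x) = 0" "(x, g x) \<in> U" if "x \<in> V0" for x
  proof -
    have w: "(x, 0) \<in> V" using that by (simp add: V0_def)
    show e: "G (x, 0) = (x, g x)"
      using GU(2)[OF w] by (simp add: F_def g_def prod_eq_iff)
    show "\<psi> (x, g x) = 0" "(x, g x) \<in> U"
      using GU[OF w] U'(2) unfolding e by (auto simp: F_def)
  qed
  have nz': "d (x, g x) (0, 1) \<noteq> 0" if "x \<in> V0" for x
  proof
    assume "d (x, g x) (0, 1) = 0"
    then have "blinfun_apply (F' (x, g x)) (0, 1) = blinfun_apply (F' (x, g x)) 0"
      using bounded_linear.linear[OF lin[OF Gx(3)[OF that]]] by (simp add: F'_apply[OF Gx(3)[OF that]] linear_0)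
    moreover have "inj (blinfun_apply (F' (x, g x)))"
      using bij[of "(x, 0)"] that by (simp add: V0_def Gx bij_is_inj)
    ultimately show False
      by (metis injD zero_neq_one prod.inject zero_prod_def)
  qed
  have derg: "(g has_derivative (\<lambda>h. - (d (x, g x) (h, 0) * inverse (d (x, g x) (0, 1))))) (at x)"
    if "x \<in> V0" for x
  proof -
    have "((\<lambda>x. (x, 0::real)) has_derivative (\<lambda>h. (h, 0))) (at x)"
      by (intro has_derivative_Pair has_derivative_ident has_derivative_const)
    from has_derivative_compose[OF this derG[of "(x, 0)"]] that
    have "((\<lambda>x. G (x, 0)) has_derivative (\<lambda>h. G' (x, 0) (h, 0))) (at x)"
      by (simp add: V0_def)
    then have dg: "(g has_derivative (\<lambda>h. snd (G' (x, 0) (h, 0)))) (at x)" (is "(g has_derivative ?g') _")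
      unfolding g_def by (rule has_derivative_snd)
    have "((\<lambda>x. (x, g x)) has_derivative (\<lambda>h. (h, ?g' h))) (at x)"
      by (intro has_derivative_Pair has_derivative_ident dg)
    from diff_chain_at[OF this dpsi[OF Gx(3)[OF that]]]
    have "((\<lambda>x. \<psi> (x, g x)) has_derivative (\<lambda>h. d (x, g x) (h, ?g' h))) (at x)"
      by (simp add: o_def)
    moreover have "((\<lambda>x. \<psi> (x, g x)) has_derivative (\<lambda>h. 0)) (at x)"
      by (rule has_derivative_transform_within_open[OF has_derivative_const V0 that]) (simp add: Gx)
    ultimately have "(\<lambda>h. d (x, g x) (h, ?g' h)) = (\<lambda>h. 0)"
      by (rule has_derivative_unique)
    then have "d (x, g x) (h, ?g' h) = 0" for h
      by (rule fun_cong)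
    then have "?g' h = - (d (x, g x) (h, 0) * inverse (d (x, g x) (0, 1)))" for h
      using split[OF Gx(3)[OF that], of h "?g' h"] nz'[OF that] by (simp add: field_simps)
    then show ?thesis using dg by presburger
  qed
  have "Ck_on k V0 g" for k
  proof (induction k)
    case 0
    then show ?case
      using derg by (auto intro!: continuous_at_imp_continuous_on has_derivative_continuous)
  next
    case (Suc k)
    have *: "Ck_on k V0 (\<lambda>x. d (x, g x) v)" for v
      unfolding d_def
      by (rule Ck_on_compose[OF U(1) V0 Ck_on_Pair[OF V0 Ck_on_bounded_linear[OF bounded_linear_ident] Suc]])
        (use Gx smooth_on_derivative[OF sm, of v] in \<open>auto simp: smooth_on_def\<close>)
    have "Ck_on k V0 (\<lambda>x. (-1) * (d (x, g x) (h, 0) * inverse (d (x, g x) (0, 1))))" for h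
      by (intro Ck_on_bilinear[OF bounded_bilinear_mult] Ck_on_inverse Ck_on_const V0 * nz')
    then show ?case
      by (intro Ck_on_SucI[OF derg]) (auto simp: V0)
  qed
  then have "smooth_on V0 g" by (simp add: smooth_on_def)
  moreover have "g x0 = y0"
  proof -
    have "G (F ?z) = ?z" using hom U'(3) by (auto simp: homeomorphism_def)
    then show ?thesis using z by (simp add: F_def g_def)
  qed
  ultimately show ?thesis
    using that[OF V0 x0] Gx by blast
qed

section \<open>Lorentzian linear algebra\<close>

lemma bounded_bilinear_mink: "bounded_bilinear (mink :: 'n::finite minkowski \<Rightarrow> _)"
proof -
  have "bounded_bilinear (\<lambda>v w::'n minkowski. v \<bullet> (fst w, - snd w))"
    by (rule bounded_bilinear.comp[OF bounded_bilinear_inner bounded_linear_ident])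
      (intro bounded_linear_Pair bounded_linear_fst bounded_linear_minus bounded_linear_snd)
  moreover have "mink = (\<lambda>v w::'n minkowski. v \<bullet> (fst w, - snd w))"
    by (auto simp: mink_def inner_prod_def fun_eq_iff)
  ultimately show ?thesis by simp
qed

interpretation mink: bounded_bilinear mink
  by (rule bounded_bilinear_mink)

lemmas mink_simps = mink.add_left mink.add_right mink.diff_left mink.diff_right
  mink.scaleR_left mink.scaleR_right mink.minus_left mink.minus_right

lemma mink_commute: "mink v w = mink w v"
  by (simp add: mink_def inner_commute)

lemma unit_timelike_snd:
  assumes "mink \<nu> \<nu> = -1"
  shows "(snd \<nu>)\<^sup>2 = 1 + (norm (fst \<nu>))\<^sup>2"
  using assms by (simp add: mink_def dot_square_norm flip: power2_eq_square)

text \<open>The orthogonal complement of a timelike vector is spacelike.\<close>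

lemma mink_orthogonal_timelike:
  assumes \<nu>: "mink \<nu> \<nu> = -1" and orth: "mink u \<nu> = 0" and le: "mink u u \<le> 0"
  shows "u = 0"
proof -
  define x t n a where "x = fst u" "t = snd u" "n = fst \<nu>" "a = snd \<nu>"
  have a: "a\<^sup>2 = 1 + (norm n)\<^sup>2" using unit_timelike_snd[OF \<nu>] by (simp add: x_t_n_a_def)
  have xt: "(norm x)\<^sup>2 \<le> t\<^sup>2" using le by (simp add: mink_def x_t_n_a_def dot_square_norm flip: power2_eq_square)
  have "(t * a)\<^sup>2 = (x \<bullet> n)\<^sup>2" using orth by (simp add: mink_def x_t_n_a_def)
  also have "\<dots> \<le> (norm x)\<^sup>2 * (norm n)\<^sup>2"
    using Cauchy_Schwarz_ineq[of x n] by (simp add: power2_norm_eq_inner)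
  also have "\<dots> \<le> t\<^sup>2 * (norm n)\<^sup>2" using xt by (intro mult_right_mono) auto
  finally have "t\<^sup>2 \<le> 0" using a by (simp add: power_mult_distrib algebra_simps)
  then have "t = 0" by simp
  moreover have "x = 0" using xt \<open>t = 0\<close> by simp
  ultimately show ?thesis by (simp add: x_t_n_a_def prod_eq_iff)
qed

text \<open>With \<open>u = (x, t)\<close>, \<open>N = (n, a)\<close> and \<open>y = \<langle>u, N\<rangle>\<close> one has \<open>t * a = x \<bullet> n - y\<close>, so that the claim
  \<open>t\<^sup>2 \<le> \<bar>x\<bar>\<^sup>2 + y\<^sup>2\<close> is the Cauchy-Schwarz inequality for \<open>(x, y)\<close> and \<open>(n, -1)\<close>.\<close>

lemma mink_psd:
  assumes N: "mink N N = -1"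
  shows "0 \<le> mink u u + (mink u N)\<^sup>2"
proof -
  define x t n a where "x = fst u" "t = snd u" "n = fst N" "a = snd N"
  define y where "y = mink u N"
  have a: "a\<^sup>2 = 1 + (norm n)\<^sup>2" using unit_timelike_snd[OF N] by (simp add: x_t_n_a_def)
  have ta: "t * a = x \<bullet> n - y" by (simp add: y_def mink_def x_t_n_a_def)
  have "(t * a)\<^sup>2 = ((x, y) \<bullet> (n, -1))\<^sup>2" by (simp add: ta)
  also have "\<dots> \<le> ((x, y) \<bullet> (x, y)) * ((n, - 1::real) \<bullet> (n, -1))"
    by (rule Cauchy_Schwarz_ineq)
  also have "\<dots> = ((norm x)\<^sup>2 + y\<^sup>2) * a\<^sup>2"
    by (simp add: a dot_square_norm norm_prod_def add.commute)
  finally have "t\<^sup>2 \<le> (norm x)\<^sup>2 + y\<^sup>2"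
    using a by (simp add: power_mult_distrib mult_le_cancel_right add_pos_nonneg)
  then show ?thesis
    by (simp add: y_def mink_def x_t_n_a_def dot_square_norm flip: power2_eq_square)
qed

text \<open>Flipping the sign of the timelike direction \<open>N\<close> turns the Minkowski product into the Euclidean
  inner product seen by an observer with velocity \<open>N\<close>. It plays the role of a Riemannian metric in
  the comparison of the two hypersurfaces, where all constants must be independent of \<open>N\<close>.\<close>

definition reflect :: "'n::finite minkowski \<Rightarrow> 'n minkowski \<Rightarrow> 'n minkowski" where
  "reflect N v = v + (2 * mink v N) *\<^sub>R N"

definition observer :: "'n::finite minkowski \<Rightarrow> 'n minkowski \<Rightarrow> 'n minkowski \<Rightarrow> real" where
  "observer N u v = mink u (reflect N v)"

lemma observer_alt: "observer N u v = mink u v + 2 * mink u N * mink v N"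
  by (simp add: observer_def reflect_def mink_simps)

lemma observer_commute: "observer N u v = observer N v u"
  by (simp add: observer_alt mink_commute)

lemma bounded_linear_reflect: "bounded_linear (reflect N)"
  unfolding reflect_def
  by (intro bounded_linear_add bounded_linear_ident bounded_linear_scaleR_const
      bounded_linear_const_mult mink.bounded_linear_left)

lemma bounded_bilinear_observer: "bounded_bilinear (observer N)"
  unfolding observer_def
  by (rule bounded_bilinear.comp[OF bounded_bilinear_mink bounded_linear_ident bounded_linear_reflect])

interpretation observer: bounded_bilinear "observer N" for N
  by (rule bounded_bilinear_observer)

lemmas observer_simps = observer.add_left observer.add_right observer.diff_left observer.diff_right
  observer.scaleR_left observer.scaleR_right observer.minus_left observer.minus_right

lemma observer_nonneg: "mink N N = -1 \<Longrightarrow> 0 \<le> observer N u u"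
  using mink_psd[of N u] zero_le_power2[of "mink u N"]
  unfolding observer_alt power2_eq_square by linarith

text \<open>For forms that are only semidefinite: the substitutions below avoid dividing by \<open>A\<close> or \<open>C\<close>.\<close>

lemma quadratic_form_Cauchy_Schwarz:
  fixes A M C :: real
  assumes "\<And>s t. 0 \<le> s\<^sup>2 * A + 2 * s * t * M + t\<^sup>2 * C"
  shows "M\<^sup>2 \<le> A * C"
proof -
  have A: "0 \<le> A" using assms[of 1 0] by simp
  have C: "0 \<le> C" using assms[of 0 1] by simp
  have 1: "0 \<le> C * (A * C - M\<^sup>2)" using assms[of C "-M"] by (simp add: power2_eq_square algebra_simps)
  have 2: "0 \<le> A * (A * C - M\<^sup>2)" using assms[of "-M" A] by (simp add: power2_eq_square algebra_simps)
  have 3: "0 \<le> A - 2 * M\<^sup>2 + M\<^sup>2 * C" using assms[of 1 "-M"] by (simp add: power2_eq_square algebra_simps)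
  show ?thesis
  proof (cases "A = 0 \<and> C = 0")
    case True
    then show ?thesis using 3 by simp
  next
    case False
    then have "A > 0 \<or> C > 0" using A C by linarith
    then show ?thesis using 1 2 by (auto simp: zero_le_mult_iff)
  qed
qed

text \<open>The Minkowski product is the observer product with one argument reflected, and the reflection
  is an isometry of the observer product.\<close>

lemma mink_observer_Cauchy_Schwarz:
  assumes N: "mink N N = -1"
  shows "(mink u v)\<^sup>2 \<le> observer N u u * observer N v v"
proof -
  have "(observer N u w)\<^sup>2 \<le> observer N u u * observer N w w" for w
  proof (rule quadratic_form_Cauchy_Schwarz)
    fix s t :: real
    have "0 \<le> observer N (s *\<^sub>R u + t *\<^sub>R w) (s *\<^sub>R u + t *\<^sub>R w)" by (rule observer_nonneg[OF N])
    then show "0 \<le> s\<^sup>2 * observer N u u + 2 * s * t * observer N u w + t\<^sup>2 * observer N w w"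
      by (simp add: observer_simps observer_commute[of N w u] power2_eq_square algebra_simps)
  qed
  from this[of "reflect N v"] show ?thesis
    using N by (simp add: observer_alt reflect_def mink_simps mink_commute algebra_simps)
qed

lemma observer_triple:
  assumes N: "mink N N = -1"
  shows "observer N (a + b + c) (a + b + c) \<le> 3 * (observer N a a + observer N b b + observer N c c)"
proof -
  have "0 \<le> observer N (a - b) (a - b) + observer N (b - c) (b - c) + observer N (a - c) (a - c)"
    by (intro add_nonneg_nonneg observer_nonneg N)
  then show ?thesis
    by (simp add: observer_simps observer_commute[of N b a] observer_commute[of N c a]
        observer_commute[of N c b])
qed

text \<open>The factor depends on \<open>N\<close>, so this is of use only for compactness, not for uniform estimates.\<close>

lemma norm_le_observer:
  fixes u N :: "'n::finite minkowski"
  assumes N: "mink N N = -1"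
  shows "(norm u)\<^sup>2 \<le> (1 + 2 * observer N (0, 1) (0, 1)) * observer N u u"
proof -
  have "(norm u)\<^sup>2 = mink u u + 2 * (mink u (0, 1))\<^sup>2"
    by (simp add: mink_def norm_Pair inner_prod_def dot_square_norm norm_prod_def flip: power2_eq_square)
  moreover have "(mink u (0, 1))\<^sup>2 \<le> observer N u u * observer N (0, 1) (0, 1)"
    by (rule mink_observer_Cauchy_Schwarz[OF N])
  moreover have "mink u u \<le> observer N u u"
    by (simp add: observer_alt)
  ultimately show ?thesis
    by (simp add: algebra_simps)
qed

lemma mink_future_timelike_neg:
  assumes "mink u u < 0" "0 < snd u" "mink v v < 0" "0 < snd v"
  shows "mink u v < 0"
proof -
  have *: "norm (fst w) < snd w" if "mink w w < 0" "0 < snd w" for w :: "'n::finite minkowski"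
  proof (rule power_less_imp_less_base)
    show "(norm (fst w))\<^sup>2 < (snd w)\<^sup>2"
      using that by (simp add: mink_def dot_square_norm flip: power2_eq_square)
  qed (use that in simp)
  have "fst u \<bullet> fst v \<le> norm (fst u) * norm (fst v)" by (rule norm_cauchy_schwarz)
  also have "\<dots> < snd u * snd v"
    by (rule mult_strict_mono[OF *[OF assms(1,2)] *[OF assms(3,4)] assms(2) norm_ge_zero])
  finally show ?thesis by (simp add: mink_def)
qed

text \<open>The component of \<open>V\<close> orthogonal to \<open>\<nu>\<close> is itself orthogonal to all of the hyperplane, hence null
  and spacelike at once.\<close>

lemma orthogonal_to_hyperplane:
  assumes \<nu>: "mink \<nu> \<nu> = -1" and V: "\<And>v. mink v \<nu> = 0 \<Longrightarrow> mink V v = 0"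
  shows "V = (- mink V \<nu>) *\<^sub>R \<nu>"
proof -
  define u where "u = V + mink V \<nu> *\<^sub>R \<nu>"
  have u: "mink u \<nu> = 0" using \<nu> by (simp add: u_def mink_simps)
  have "mink u u = mink V u + mink V \<nu> * mink u \<nu>" by (simp add: u_def mink_simps mink_commute algebra_simps)
  then have "mink u u = 0" using V[OF u] u by simp
  then have "u = 0" using mink_orthogonal_timelike[OF \<nu> u] by simp
  then show ?thesis by (simp add: u_def add_eq_0_iff2)
qed

section \<open>Orthonormal frames and boosts of spacelike hyperplanes\<close>

text \<open>The last clause says that the frame spans the hyperplane. It has this form because it is
  preserved by boosts and yields coordinates directly, without counting dimensions.\<close>

definition mink_frame :: "'n::finite minkowski \<Rightarrow> ('n \<Rightarrow> 'n minkowski) \<Rightarrow> bool" where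
  "mink_frame \<nu> e \<longleftrightarrow> (\<forall>i. mink (e i) \<nu> = 0) \<and> (\<forall>i. mink (e i) (e i) = 1) \<and>
     (\<forall>w. mink w \<nu> = 0 \<longrightarrow> w = (\<Sum>i\<in>UNIV. mink w (e i) *\<^sub>R e i))"

text \<open>The witness is the image of the standard basis under the boost that takes \<open>(0, 1)\<close>
  to \<open>\<nu>\<close>.\<close>

lemma mink_frame_exists:
  fixes \<nu> :: "'n::finite minkowski"
  assumes \<nu>: "mink \<nu> \<nu> = -1" and fut: "snd \<nu> > 0"
  shows "\<exists>e. mink_frame \<nu> e"
proof -
  obtain u g where ug: "\<nu> = (u, g)" by (cases \<nu>)
  have g: "g\<^sup>2 = 1 + u \<bullet> u" "g > 0" using unit_timelike_snd[OF \<nu>] fut by (auto simp: ug power2_norm_eq_inner)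
  have uu: "u \<bullet> u = (g - 1) * (1 + g)" using g by (simp add: power2_eq_square algebra_simps)
  have g1: "1 + g \<noteq> 0" using g by simp
  have quot: "u \<bullet> u / (1 + g) = g - 1" unfolding uu using g1 by (rule nonzero_mult_div_cancel_right)
  define e :: "'n \<Rightarrow> 'n minkowski" where "e i = (axis i 1 + (u $ i / (1 + g)) *\<^sub>R u, u $ i)" for i
  have ax: "axis i 1 \<bullet> u = u $ i" "u \<bullet> axis i 1 = u $ i" "axis i 1 \<bullet> axis i (1::real) = 1" for i
    by (auto simp: inner_axis inner_commute[of _ u] inner_axis_axis)
  have "mink (e i) \<nu> = 0" for i
  proof -
    have "mink (e i) \<nu> = u $ i * (1 + u \<bullet> u / (1 + g) - g)"
      by (simp add: e_def ug mink_def ax inner_add_left algebra_simps)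
    then show ?thesis by (simp add: quot)
  qed
  moreover have "mink (e i) (e i) = 1" for i
  proof -
    define k where "k = u $ i / (1 + g)"
    have k: "k * (1 + g) = u $ i" using g1 by (simp add: k_def)
    have "mink (e i) (e i) = 1 + 2 * k * u $ i + k * k * (u \<bullet> u) - (u $ i)\<^sup>2"
      by (simp add: e_def mink_def ax inner_add_left inner_add_right power2_eq_square algebra_simps flip: k_def)
    also have "\<dots> = 1 + k * (1 + g) * (2 * k + k * (g - 1) - k * (1 + g))"
      unfolding uu k[symmetric] by (simp add: power2_eq_square algebra_simps)
    finally show ?thesis by (simp add: algebra_simps)
  qed
  moreover have "w = (\<Sum>i\<in>UNIV. mink w (e i) *\<^sub>R e i)" if w: "mink w \<nu> = 0" for w
  proof -
    obtain x t where xt: "w = (x, t)" by (cases w)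
    have xu: "x \<bullet> u = t * g" using w by (simp add: xt ug mink_def)
    define m where "m i = x $ i - (t / (1 + g)) * u $ i" for i
    have coeff: "mink w (e i) = m i" for i
    proof -
      have "mink w (e i) = x $ i + u $ i * (x \<bullet> u / (1 + g) - t)"
        by (simp add: e_def xt mink_def inner_axis inner_add_right algebra_simps)
      also have "x \<bullet> u / (1 + g) - t = - (t / (1 + g))"
        unfolding xu using g1 by (simp add: field_simps)
      finally show ?thesis by (simp add: m_def algebra_simps)
    qed
    have mu: "(\<Sum>i\<in>UNIV. m i * u $ i) = t"
    proof -
      have "(\<Sum>i\<in>UNIV. m i * u $ i) = x \<bullet> u - t * (u \<bullet> u / (1 + g))"
        by (simp add: m_def inner_vec_def algebra_simps sum_subtractf sum_distrib_left sum_divide_distrib)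
      then show ?thesis by (simp add: quot xu algebra_simps)
    qed
    have mx: "(\<Sum>i\<in>UNIV. m i *\<^sub>R axis i 1) = x - (t / (1 + g)) *\<^sub>R u"
      by (simp add: vec_eq_iff m_def axis_def if_distrib cong: if_cong)
    have "(\<Sum>i\<in>UNIV. mink w (e i) *\<^sub>R e i) =
        ((\<Sum>i\<in>UNIV. m i *\<^sub>R axis i 1) + ((\<Sum>i\<in>UNIV. m i * u $ i) / (1 + g)) *\<^sub>R u, \<Sum>i\<in>UNIV. m i * u $ i)"
      unfolding coeff by (simp add: e_def prod_eq_iff fst_sum snd_sum scaleR_add_right sum.distrib
          scaleR_sum_left sum_divide_distrib)
    then show ?thesis by (simp add: mx mu xt)
  qed
  ultimately show ?thesis unfolding mink_frame_def by blast
qed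

lemma mink_frame_expand:
  assumes "mink_frame \<nu> e" "mink w \<nu> = 0"
  shows "(\<Sum>i\<in>UNIV. mink w (e i) *\<^sub>R e i) = w"
  using assms unfolding mink_frame_def by metis

lemma mink_frame_sum_squares:
  assumes e: "mink_frame \<nu> e" and \<nu>: "mink \<nu> \<nu> = -1"
  shows "(\<Sum>i\<in>UNIV. (mink N (e i))\<^sup>2) = mink N N + (mink N \<nu>)\<^sup>2"
proof -
  define w where "w = N + mink N \<nu> *\<^sub>R \<nu>"
  have w: "mink w \<nu> = 0" using \<nu> by (simp add: w_def mink_simps)
  have we: "mink w (e i) = mink N (e i)" for i
    using e by (simp add: w_def mink_simps mink_frame_def mink_commute[of \<nu>])
  have "w = (\<Sum>i\<in>UNIV. mink w (e i) *\<^sub>R e i)"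
    using mink_frame_expand[OF e w] by simp
  then have "mink w w = mink w (\<Sum>i\<in>UNIV. mink w (e i) *\<^sub>R e i)" by simp
  also have "\<dots> = (\<Sum>i\<in>UNIV. (mink N (e i))\<^sup>2)"
    by (simp add: mink.sum_right mink_simps we power2_eq_square)
  finally show ?thesis
    using \<nu> by (simp add: w_def mink_simps mink_commute[of \<nu> N] power2_eq_square)
qed

text \<open>An observer \<open>N\<close> whose velocity differs from \<open>\<nu>\<close> by a boost of bounded size measures frames of the
  hyperplane \<open>\<nu>\<^sup>\<bottom>\<close> with bounded length, however large the velocity of both relative to \<open>(0, 1)\<close>.\<close>

lemma mink_frame_observer_sum:
  fixes e :: "'n::finite \<Rightarrow> 'n minkowski"
  assumes e: "mink_frame \<nu> e" and \<nu>: "mink \<nu> \<nu> = -1" and N: "mink N N = -1" and b: "(mink N \<nu>)\<^sup>2 \<le> 4"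
  shows "(\<Sum>i\<in>UNIV. observer N (e i) (e i)) \<le> 7 * CARD('n)"
proof -
  have "(\<Sum>i\<in>UNIV. observer N (e i) (e i)) = CARD('n) + 2 * (\<Sum>i\<in>UNIV. (mink N (e i))\<^sup>2)"
    using e by (simp add: observer_alt mink_frame_def sum.distrib sum_distrib_left power2_eq_square mink_commute[of _ N] mult.assoc)
  also have "\<dots> \<le> CARD('n) + 6"
    using mink_frame_sum_squares[OF e \<nu>, of N] N b by simp
  also have "\<dots> \<le> 7 * real CARD('n)"
    using zero_less_card_finite[where 'a='n] by linarith
  finally show ?thesis by simp
qed

text \<open>The pure boost in the plane of \<open>\<nu>\<close> and \<open>\<nu>'\<close> that takes \<open>\<nu>'\<close> to \<open>\<nu>\<close>, by a formula that is valid
  on the orthogonal complement of \<open>\<nu>'\<close>.\<close>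

definition boost :: "'n::finite minkowski \<Rightarrow> 'n minkowski \<Rightarrow> 'n minkowski \<Rightarrow> 'n minkowski" where
  "boost \<nu> \<nu>' v = v + (mink v \<nu> / (1 - mink \<nu> \<nu>')) *\<^sub>R (\<nu> + \<nu>')"

context
  fixes \<nu> \<nu>' :: "'n::finite minkowski"
  assumes \<nu>: "mink \<nu> \<nu> = -1" and \<nu>': "mink \<nu>' \<nu>' = -1" and neg: "mink \<nu> \<nu>' < 0"
begin

lemma boost_orthogonal: "mink (boost \<nu> \<nu>' v) \<nu> = 0"
proof -
  have "mink (boost \<nu> \<nu>' v) \<nu> = mink v \<nu> + mink v \<nu> / (1 - mink \<nu> \<nu>') * (mink \<nu> \<nu>' - 1)"
    using \<nu> by (simp add: boost_def mink_simps mink_commute[of \<nu>' \<nu>])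
  then show ?thesis using neg by (simp add: field_simps)
qed

lemma boost_isometry:
  assumes "mink v \<nu>' = 0" "mink w \<nu>' = 0"
  shows "mink (boost \<nu> \<nu>' v) (boost \<nu> \<nu>' w) = mink v w"
proof -
  define D a b where "D = 1 - mink \<nu> \<nu>'" "a = mink v \<nu>" "b = mink w \<nu>"
  have D: "D \<noteq> 0" using neg by (simp add: D_a_b_def)
  have "mink (\<nu> + \<nu>') (\<nu> + \<nu>') = - 2 * D"
    using \<nu> \<nu>' by (simp add: mink_simps mink_commute[of \<nu>' \<nu>] D_a_b_def)
  moreover have "mink v (\<nu> + \<nu>') = a" "mink (\<nu> + \<nu>') w = b"
    using assms by (simp_all add: mink_simps D_a_b_def mink_commute[of _ w])
  moreover have "boost \<nu> \<nu>' v = v + (a / D) *\<^sub>R (\<nu> + \<nu>')" "boost \<nu> \<nu>' w = w + (b / D) *\<^sub>R (\<nu> + \<nu>')"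
    by (simp_all add: boost_def D_a_b_def)
  ultimately have "mink (boost \<nu> \<nu>' v) (boost \<nu> \<nu>' w) =
      mink v w + (b / D) * a + (a / D) * (b + (b / D) * (- 2 * D))"
    by (simp only: mink.add_left[of v] mink.add_right[of _ w] mink.scaleR_left mink.scaleR_right real_scaleR_def)
      (simp add: algebra_simps)
  then show ?thesis using D by (simp add: field_simps)
qed

lemma boost_inverse: "mink v \<nu>' = 0 \<Longrightarrow> boost \<nu>' \<nu> (boost \<nu> \<nu>' v) = v"
proof -
  assume v: "mink v \<nu>' = 0"
  define D b where "D = 1 - mink \<nu> \<nu>'" "b = mink v \<nu> / D"
  have D: "D \<noteq> 0" using neg by (simp add: D_b_def)
  have y: "boost \<nu> \<nu>' v = v + b *\<^sub>R (\<nu> + \<nu>')" by (simp add: boost_def D_b_def)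
  have "mink (v + b *\<^sub>R (\<nu> + \<nu>')) \<nu>' = - b * D"
    using v \<nu>' by (simp add: mink_simps D_b_def(1) algebra_simps)
  then show ?thesis
    unfolding y using D by (simp add: boost_def[of \<nu>' \<nu>] mink_commute[of \<nu>' \<nu>] D_b_def(1)[symmetric] add.commute)
qed

text \<open>The correction that the boost adds to \<open>v\<close> is a multiple of \<open>\<nu> + \<nu>'\<close> by a factor with the sign
  of \<open>\<langle>v, \<nu>\<rangle> = \<langle>v, \<nu> + \<nu>'\<rangle>\<close>, so it contributes a square. This sign is what makes the tilt between the two
  hypersurfaces harmless in the traced second variation.\<close>

lemma boost_expands: "mink v \<nu>' = 0 \<Longrightarrow> mink v v \<le> mink v (boost \<nu> \<nu>' v)"
  using neg by (simp add: boost_def mink_simps)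

end

lemma mink_frame_boost:
  assumes \<nu>: "mink \<nu> \<nu> = -1" and \<nu>': "mink \<nu>' \<nu>' = -1" and neg: "mink \<nu> \<nu>' < 0"
    and e: "mink_frame \<nu>' e"
  shows "mink_frame \<nu> (\<lambda>i. boost \<nu> \<nu>' (e i))"
  unfolding mink_frame_def
proof (intro conjI allI impI)
  have ei: "mink (e i) \<nu>' = 0" for i using e by (simp add: mink_frame_def)
  show "mink (boost \<nu> \<nu>' (e i)) \<nu> = 0" for i
    by (rule boost_orthogonal[OF \<nu> \<nu>' neg])
  show "mink (boost \<nu> \<nu>' (e i)) (boost \<nu> \<nu>' (e i)) = 1" for i
    using boost_isometry[OF \<nu> \<nu>' neg ei ei] e by (simp add: mink_frame_def)
  fix w assume w: "mink w \<nu> = 0"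
  have neg': "mink \<nu>' \<nu> < 0" using neg by (simp add: mink_commute)
  define c where "c = boost \<nu>' \<nu> w"
  have c: "mink c \<nu>' = 0" unfolding c_def by (rule boost_orthogonal[OF \<nu>' \<nu> neg'])
  have wc: "w = boost \<nu> \<nu>' c" unfolding c_def by (rule boost_inverse[OF \<nu>' \<nu> neg' w, symmetric])
  have lin: "linear (boost \<nu> \<nu>')"
    by (rule linearI) (simp_all add: boost_def mink_simps add_divide_distrib scaleR_add_left scaleR_add_right)
  have "w = boost \<nu> \<nu>' (\<Sum>i\<in>UNIV. mink c (e i) *\<^sub>R e i)"
    using mink_frame_expand[OF e c] wc by simp
  also have "\<dots> = (\<Sum>i\<in>UNIV. mink c (e i) *\<^sub>R boost \<nu> \<nu>' (e i))"
    by (simp add: linear_sum[OF lin] linear_scale[OF lin])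
  also have "\<dots> = (\<Sum>i\<in>UNIV. mink w (boost \<nu> \<nu>' (e i)) *\<^sub>R boost \<nu> \<nu>' (e i))"
    unfolding wc by (simp add: boost_isometry[OF \<nu> \<nu>' neg c ei])
  finally show "w = \<dots>" .
qed

section \<open>Entire spacelike graphs\<close>

lemma smooth_on_compose:
  fixes f :: "'a::real_normed_vector \<Rightarrow> 'b::euclidean_space"
  assumes "open U" "open V" "smooth_on V f" "f ` V \<subseteq> U" "smooth_on U g"
  shows "smooth_on V (\<lambda>x. g (f x))"
  using assms Ck_on_compose unfolding smooth_on_def by metis

lemma smooth_on_affine_curve: "smooth_on U (\<lambda>s::real. p + s *\<^sub>R v)" if "open U"
  unfolding smooth_on_def
  by (intro allI Ck_on_add that Ck_on_const Ck_on_bounded_linear bounded_linear_scaleR_left)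

text \<open>If the differential of a defining function vanished on the vertical direction, the implicit
  function theorem would produce a curve in the hypersurface with vertical velocity.\<close>

lemma defining_function_vertical_derivative:
  fixes S :: "'n::finite minkowski set" and \<phi> :: "'n minkowski \<Rightarrow> real"
  assumes S: "spacelike_hypersurface S" and U: "open U" "p \<in> U" and p: "p \<in> S"
    and sm: "smooth_on U \<phi>" and v: "frechet_derivative \<phi> (at p) v \<noteq> 0"
    and SU: "S \<inter> U = {q \<in> U. \<phi> q = 0}"
  shows "frechet_derivative \<phi> (at p) (0, 1) \<noteq> 0"
proof
  assume vert: "frechet_derivative \<phi> (at p) (0, 1) = 0"
  define d where "d = frechet_derivative \<phi> (at p)"
  have dphi: "(\<phi> has_derivative d) (at p)"
    unfolding d_def by (rule smooth_on_has_derivative[OF sm U(2)])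
  then have lin: "linear d" by (rule has_derivative_linear)
  define L :: "real \<times> real \<Rightarrow> 'n minkowski" where "L z = p + (fst z *\<^sub>R (0, 1) + snd z *\<^sub>R v)" for z
  define W where "W = L -` U"
  have contL: "continuous_on UNIV L" unfolding L_def by (intro continuous_intros)
  have W: "open W" unfolding W_def by (rule open_vimage[OF U(1) contL])
  have W0: "(0, 0) \<in> W" using U(2) by (simp add: W_def L_def zero_prod_def[symmetric])
  have smL: "smooth_on W L"
    unfolding smooth_on_def L_def
    by (intro allI Ck_on_add W Ck_on_const Ck_on_bounded_linear bounded_linear_add
        bounded_linear_scaleR_const bounded_linear_fst bounded_linear_snd)
  have sm\<psi>: "smooth_on W (\<lambda>z. \<phi> (L z))"
    by (rule smooth_on_compose[OF U(1) W smL _ sm]) (auto simp: W_def)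
  have "(L has_derivative (\<lambda>h. fst h *\<^sub>R (0, 1) + snd h *\<^sub>R v)) (at (0, 0))"
    unfolding L_def by (auto intro!: derivative_eq_intros)
  moreover have "(\<phi> has_derivative d) (at (L (0, 0)))"
    using dphi by (simp add: L_def zero_prod_def[symmetric])
  ultimately have d\<psi>: "((\<lambda>z. \<phi> (L z)) has_derivative (\<lambda>h. d (fst h *\<^sub>R (0, 1) + snd h *\<^sub>R v))) (at (0, 0))"
    by (rule has_derivative_compose)
  have nz: "frechet_derivative (\<lambda>z. \<phi> (L z)) (at (0, 0)) (0, 1) \<noteq> 0"
    unfolding frechet_derivative_at[OF d\<psi>, symmetric] using v by (simp add: d_def zero_prod_def[symmetric])
  have z: "\<phi> (L (0, 0)) = 0"
    using p SU U(2) by (auto simp: L_def zero_prod_def[symmetric])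
  obtain V g where V: "open V" "0 \<in> V" and g: "smooth_on V g" "g 0 = 0"
    and zero: "\<And>s. s \<in> V \<Longrightarrow> (s, g s) \<in> W \<and> \<phi> (L (s, g s)) = 0"
    using implicit_function_smooth[OF W W0 sm\<psi> z nz] by metis
  obtain e where e: "e > 0" "ball 0 e \<subseteq> V" using V openE by blast
  have ball: "ball 0 e = {-e<..<e}" for e :: real by (auto simp: dist_real_def)
  define c where "c s = L (s, g s)" for s
  define g' where "g' = frechet_derivative g (at 0)"
  have dg: "(g has_derivative g') (at 0)"
    unfolding g'_def by (rule smooth_on_has_derivative[OF g(1) V(2)])
  have dc: "(c has_derivative (\<lambda>h. h *\<^sub>R (0, 1) + g' h *\<^sub>R v)) (at 0)"
    unfolding c_def L_def fst_conv snd_conv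
    by (rule has_derivative_eq_rhs, (rule derivative_intros dg)+) simp
  have c0: "c 0 = p" by (simp add: c_def L_def g zero_prod_def[symmetric])
  have "((\<lambda>s. \<phi> (c s)) has_derivative (\<lambda>h. d (h *\<^sub>R (0, 1) + g' h *\<^sub>R v))) (at 0)"
    by (rule has_derivative_compose[OF dc]) (use dphi c0 in simp)
  moreover have "((\<lambda>s. \<phi> (c s)) has_derivative (\<lambda>h. 0)) (at 0)"
    by (rule has_derivative_transform_within_open[OF has_derivative_const V])
      (simp add: zero c_def)
  ultimately have "(\<lambda>h. d (h *\<^sub>R (0, 1) + g' h *\<^sub>R v)) = (\<lambda>h. 0)"
    by (rule has_derivative_unique)
  then have "d (1 *\<^sub>R (0, 1) + g' 1 *\<^sub>R v) = 0" by (rule fun_cong)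
  then have "g' 1 = 0"
    using vert v by (simp only: linear_add[OF lin] linear_scale[OF lin]) (simp add: d_def)
  then have "g' h = 0" for h
    using linear_scale[OF has_derivative_linear[OF dg], of h 1] by simp
  then have "(c has_vector_derivative (0, 1)) (at 0)"
    using dc by (simp add: has_vector_derivative_def)
  moreover have "smooth_on {-e<..<e} c"
  proof -
    have "smooth_on {-e<..<e} (\<lambda>s. (s, g s))"
      using g(1) e(2) unfolding smooth_on_def ball
      by (intro allI Ck_on_Pair Ck_on_bounded_linear[OF bounded_linear_ident])
        (auto intro: Ck_on_subset[of _ V])
    from smooth_on_compose[OF W _ this _ smL] show ?thesis
      using zero e(2) unfolding c_def ball by auto
  qed
  moreover have "c ` {-e<..<e} \<subseteq> S"
  proof (rule image_subsetI)
    fix s assume "s \<in> {-e<..<e}"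
    then have "s \<in> V" using e(2) ball by auto
    then have "c s \<in> {q \<in> U. \<phi> q = 0}" using zero by (simp add: c_def W_def)
    then show "c s \<in> S" using SU by blast
  qed
  ultimately have "(0, 1) \<in> tangent_space S p"
    using e(1) c0 unfolding tangent_space_def by blast
  moreover have "(0, 1) \<noteq> (0 :: 'n minkowski)" by (simp add: zero_prod_def)
  ultimately have "mink (0, 1) ((0, 1) :: 'n minkowski) > 0"
    using S p unfolding spacelike_hypersurface_def by blast
  then show False by (simp add: mink_def)
qed

text \<open>Near each of its points the hypersurface contains the graph of a smooth implicit function, and
  as it is itself a graph, the two graphs coincide there.\<close>

lemma smooth_on_entire_spacelike:
  fixes f :: "real ^ 'n::finite \<Rightarrow> real"
  assumes S: "spacelike_hypersurface S" and f: "S = {(x, f x) | x. True}"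
  shows "smooth_on UNIV f"
  unfolding smooth_on_def
proof (intro allI Ck_on_local)
  fix k and x :: "real ^ 'n"
  have p: "(x, f x) \<in> S" using f by blast
  obtain U \<phi> where U: "open U" "(x, f x) \<in> U" and sm: "smooth_on U \<phi>"
    and nz: "\<forall>q\<in>U. \<exists>v. frechet_derivative \<phi> (at q) v \<noteq> 0" and SU: "S \<inter> U = {q \<in> U. (\<phi> q::real) = 0}"
    using S p unfolding spacelike_hypersurface_def smooth_hypersurface_def by blast
  obtain v where v: "frechet_derivative \<phi> (at (x, f x)) v \<noteq> 0" using nz U(2) by blast
  have "\<phi> (x, f x) = 0" using p U SU by blast
  then obtain V g where V: "open V" "x \<in> V" and g: "smooth_on V g"
    and zero: "\<And>x. x \<in> V \<Longrightarrow> (x, g x) \<in> U \<and> \<phi> (x, g x) = 0"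
    using implicit_function_smooth[OF U sm _ defining_function_vertical_derivative[OF S U p sm v SU]]
    by metis
  have "g y = f y" if "y \<in> V" for y
  proof -
    have "(y, g y) \<in> S" using zero[OF that] SU by blast
    then show ?thesis using f by auto
  qed
  then have "Ck_on k V f"
    using Ck_on_cong_imp[OF V(1)] g unfolding smooth_on_def by metis
  then show "\<exists>V. open V \<and> x \<in> V \<and> Ck_on k V f" using V by blast
qed

definition grad :: "(real ^ 'n::finite \<Rightarrow> real) \<Rightarrow> real ^ 'n \<Rightarrow> real ^ 'n" where
  "grad f x = (\<chi> i. frechet_derivative f (at x) (axis i 1))"

lemma has_derivative_grad:
  assumes "smooth_on UNIV f"
  shows "(f has_derivative (\<lambda>v. grad f x \<bullet> v)) (at x)"
proof -
  have d: "(f has_derivative frechet_derivative f (at x)) (at x)"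
    by (rule smooth_on_has_derivative[OF assms]) simp
  then have lin: "linear (frechet_derivative f (at x))" by (rule has_derivative_linear)
  have "frechet_derivative f (at x) v = grad f x \<bullet> v" for v
  proof -
    have "frechet_derivative f (at x) v = frechet_derivative f (at x) (\<Sum>i\<in>UNIV. v $ i *\<^sub>R axis i 1)"
      using basis_expansion[of v] by (simp add: scalar_mult_eq_scaleR)
    also have "\<dots> = grad f x \<bullet> v"
      by (simp add: linear_sum[OF lin] linear_scale[OF lin] grad_def inner_vec_def mult.commute)
    finally show ?thesis .
  qed
  then have "frechet_derivative f (at x) = (\<lambda>v. grad f x \<bullet> v)" by (rule ext)
  then show ?thesis using d by simp
qed

lemma differentiable_grad:
  assumes "smooth_on UNIV f"
  shows "grad f differentiable (at x)"
proof -
  have "(\<lambda>x. frechet_derivative f (at x) v) differentiable (at x)" for v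
    using smooth_on_has_derivative[OF smooth_on_derivative[OF assms]] by (auto simp: differentiable_def)
  then have "(\<lambda>x. \<Sum>i\<in>UNIV. frechet_derivative f (at x) (axis i 1) *\<^sub>R axis i (1::real)) differentiable (at x)"
    by (intro differentiable_sum differentiable_scaleR) auto
  moreover have "grad f = (\<lambda>x. \<Sum>i\<in>UNIV. frechet_derivative f (at x) (axis i 1) *\<^sub>R axis i (1::real))"
    by (simp add: fun_eq_iff grad_def vec_eq_iff axis_def if_distrib cong: if_cong)
  ultimately show ?thesis by simp
qed

text \<open>Straight lines in the base, lifted to the graph, realise all the vectors on the right.\<close>

lemma tangent_space_graph:
  fixes f :: "real ^ 'n::finite \<Rightarrow> real"
  assumes sm: "smooth_on UNIV f" and S: "S = {(x, f x) | x. True}"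
  shows "tangent_space S (x, f x) = {(v, grad f x \<bullet> v) | v. True}"
proof (intro equalityI subsetI)
  fix w assume "w \<in> tangent_space S (x, f x)"
  then obtain c e where e: "e > 0" and c: "c ` {-e<..<e} \<subseteq> S" "c 0 = (x, f x)"
    and dc: "(c has_derivative (\<lambda>h. h *\<^sub>R w)) (at 0)"
    unfolding tangent_space_def has_vector_derivative_def by blast
  have "((\<lambda>s. snd (c s)) has_derivative (\<lambda>h. snd (h *\<^sub>R w))) (at 0)"
    by (rule has_derivative_snd[OF dc])
  moreover have "((\<lambda>s. snd (c s)) has_derivative (\<lambda>h. grad f x \<bullet> fst (h *\<^sub>R w))) (at 0)"
  proof (rule has_derivative_transform_within_open)
    show "((\<lambda>s. f (fst (c s))) has_derivative (\<lambda>h. grad f x \<bullet> fst (h *\<^sub>R w))) (at 0)"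
      by (rule has_derivative_compose[OF has_derivative_fst[OF dc]])
        (use c(2) has_derivative_grad[OF sm] in simp)
    show "open {-e<..<e}" "0 \<in> {-e<..<e}" using e by auto
    show "f (fst (c s)) = snd (c s)" if "s \<in> {-e<..<e}" for s
      using c(1) that S by fastforce
  qed
  ultimately have "(\<lambda>h. snd (h *\<^sub>R w)) = (\<lambda>h. grad f x \<bullet> fst (h *\<^sub>R w))"
    by (rule has_derivative_unique)
  from fun_cong[OF this, of 1] have "w = (fst w, grad f x \<bullet> fst w)"
    by (simp add: prod_eq_iff)
  then show "w \<in> {(v, grad f x \<bullet> v) | v. True}" by blast
next
  fix w assume "w \<in> {(v, grad f x \<bullet> v) | v. True}"
  then obtain v where w: "w = (v, grad f x \<bullet> v)" by blast
  define c where "c = (\<lambda>s::real. (x + s *\<^sub>R v, f (x + s *\<^sub>R v)))"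
  have "smooth_on {-1<..<1} c"
    unfolding c_def smooth_on_def
    using smooth_on_compose[OF open_UNIV _ smooth_on_affine_curve _ sm, of "{-1<..<1}" x v]
      smooth_on_affine_curve[of "{-1<..<1}" x v]
    by (intro allI Ck_on_Pair) (auto simp: smooth_on_def)
  moreover have "(c has_vector_derivative w) (at 0)"
  proof -
    have l: "((\<lambda>s. x + s *\<^sub>R v) has_derivative (\<lambda>h. h *\<^sub>R v)) (at (0::real))"
      by (auto intro!: derivative_eq_intros)
    have "((\<lambda>s. f (x + s *\<^sub>R v)) has_derivative (\<lambda>h. grad f x \<bullet> (h *\<^sub>R v))) (at 0)"
      by (rule has_derivative_compose[OF l]) (use has_derivative_grad[OF sm] in simp)
    from has_derivative_Pair[OF l this] show ?thesis
      by (simp add: c_def has_vector_derivative_def w)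
  qed
  ultimately show "w \<in> tangent_space S (x, f x)"
    unfolding tangent_space_def S by (auto simp: c_def intro!: exI[of _ c] exI[of _ "1::real"])
qed

text \<open>The form in which an entire spacelike hypersurface is used from here on.\<close>

locale spacelike_graph =
  fixes f :: "real ^ 'n::finite \<Rightarrow> real" and S :: "'n minkowski set"
  assumes smooth: "smooth_on UNIV f" and S_eq: "S = {(x, f x) | x. True}"
    and norm_grad: "norm (grad f x) < 1"

lemma spacelike_graph_entire:
  assumes S: "spacelike_hypersurface S" and "entire S"
  obtains f where "spacelike_graph f S"
proof -
  from \<open>entire S\<close> obtain f where f: "S = {(x, f x) | x. True}" unfolding entire_def by blast
  have sm: "smooth_on UNIV f" by (rule smooth_on_entire_spacelike[OF S f])
  have "norm (grad f x) < 1" for x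
  proof (rule ccontr)
    assume "\<not> norm (grad f x) < 1"
    then have ge: "1 \<le> norm (grad f x)" by simp
    then have nz: "grad f x \<noteq> 0" by auto
    let ?w = "(grad f x, grad f x \<bullet> grad f x)"
    have "(x, f x) \<in> S" "?w \<in> tangent_space S (x, f x)"
      using f tangent_space_graph[OF sm f] by auto
    then have "mink ?w ?w > 0"
      using S nz unfolding spacelike_hypersurface_def by (metis prod.inject zero_prod_def)
    then have "(norm (grad f x))\<^sup>2 * (norm (grad f x))\<^sup>2 < (norm (grad f x))\<^sup>2 * 1"
      by (simp add: mink_def dot_square_norm)
    moreover have "(norm (grad f x))\<^sup>2 * 1 \<le> (norm (grad f x))\<^sup>2 * (norm (grad f x))\<^sup>2"
      by (intro mult_left_mono one_le_power ge) simp
    ultimately show False by linarith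
  qed
  then have "spacelike_graph f S" using sm f by unfold_locales
  then show ?thesis by (rule that)
qed

text \<open>Expand \<open>A b\<close> for a basis vector \<open>b\<close> in the vectors \<open>A (e i)\<close> and exchange the two sums: the sum over
  the basis then reassembles \<open>A (e i)\<close> from its coordinates.\<close>

lemma trace_on_frame:
  fixes e :: "'n::finite \<Rightarrow> 'n minkowski"
  assumes T: "T = {w. mink w \<nu> = 0}" and A: "linear A" "\<And>w. w \<in> T \<Longrightarrow> A w \<in> T"
    and e: "mink_frame \<nu> e"
  shows "trace_on T A = (\<Sum>i\<in>UNIV. mink (A (e i)) (e i))"
proof -
  define B where "B = (SOME B. independent B \<and> span B = T)"
  have "subspace T"
    unfolding T by (auto simp: subspace_def mink_simps mink.zero_left)
  then have "\<exists>B. independent B \<and> span B = T"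
    using basis_exists[of T] span_subspace by metis
  from someI_ex[OF this] have B: "independent B" "span B = T"
    unfolding B_def by auto
  have finB: "finite B" using B(1) by (rule independent_imp_finite)
  have eT: "e i \<in> T" for i using e by (simp add: T mink_frame_def)
  have repA: "representation B (A b) b' = (\<Sum>i\<in>UNIV. mink b (e i) * representation B (A (e i)) b')"
    if "b \<in> T" for b b'
  proof -
    have "A b = A (\<Sum>i\<in>UNIV. mink b (e i) *\<^sub>R e i)"
      using mink_frame_expand[OF e, of b] that T by simp
    also have "\<dots> = (\<Sum>i\<in>UNIV. mink b (e i) *\<^sub>R A (e i))"
      by (simp add: linear_sum[OF A(1)] linear_scale[OF A(1)])
    finally show ?thesis
      by (simp add: real_vector.representation_sum[OF B(1)] real_vector.representation_scale[OF B(1)]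
          A(2)[OF eT, folded B(2)] span_scale)
  qed
  have BT: "b \<in> T" if "b \<in> B" for b using B(2) that span_base by blast
  have "trace_on T A = (\<Sum>b\<in>B. representation B (A b) b)"
    unfolding trace_on_def B_def Let_def ..
  also have "\<dots> = (\<Sum>b\<in>B. \<Sum>i\<in>UNIV. mink b (e i) * representation B (A (e i)) b)"
    by (intro sum.cong refl repA BT)
  also have "\<dots> = (\<Sum>i\<in>UNIV. mink (\<Sum>b\<in>B. representation B (A (e i)) b *\<^sub>R b) (e i))"
    by (subst sum.swap) (simp add: mink.sum_left mink.scaleR_left mult.commute)
  also have "\<dots> = (\<Sum>i\<in>UNIV. mink (A (e i)) (e i))"
    using A(2)[OF eT] B by (simp add: real_vector.sum_representation_eq finB)
  finally show ?thesis .
qed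

text \<open>All that is needed of a hypersurface near a point: it contains curves with every initial velocity
  orthogonal to \<open>\<nu>\<close>, and the accelerations of these curves have the normal component that
  the second fundamental form \<open>h\<close> prescribes.\<close>

definition second_form_at ::
  "'n::finite minkowski set \<Rightarrow> 'n minkowski \<Rightarrow> 'n minkowski \<Rightarrow> ('n minkowski \<Rightarrow> real) \<Rightarrow> bool" where
  "second_form_at S p \<nu> h \<longleftrightarrow> mink \<nu> \<nu> = -1 \<and> snd \<nu> > 0 \<and> (\<forall>t v. h (t *\<^sub>R v) = t\<^sup>2 * h v) \<and>
     (\<forall>v. mink v \<nu> = 0 \<longrightarrow> (\<exists>c c' k. range c \<subseteq> S \<and> c 0 = p \<and>
       (\<forall>s. (c has_vector_derivative c' s) (at s)) \<and> c' 0 = v \<and>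
       (c' has_vector_derivative k) (at 0) \<and> mink k \<nu> = - h v))"

context spacelike_graph
begin

definition normal :: "real ^ 'n \<Rightarrow> 'n minkowski" where
  "normal x = inverse (sqrt (1 - grad f x \<bullet> grad f x)) *\<^sub>R (grad f x, 1)"

lemma grad_square: "grad f x \<bullet> grad f x < 1"
  using norm_grad[of x] by (simp add: dot_square_norm abs_square_less_1)

lemma normal_unit: "mink (normal x) (normal x) = -1" and normal_future: "snd (normal x) > 0"
proof -
  define r where "r = sqrt (1 - grad f x \<bullet> grad f x)"
  have r: "r > 0" "r * r = 1 - grad f x \<bullet> grad f x"
    using grad_square[of x] by (simp_all add: r_def)
  have "mink (normal x) (normal x) = inverse r * inverse r * (grad f x \<bullet> grad f x - 1)"
    unfolding normal_def r_def[symmetric] by (simp add: mink_def algebra_simps)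
  also have "grad f x \<bullet> grad f x - 1 = - (r * r)" using r by simp
  finally show "mink (normal x) (normal x) = -1" using r(1) by (simp add: field_simps)
  show "snd (normal x) > 0" using r(1) by (simp add: normal_def r_def[symmetric])
qed

lemma tangent_space_normal: "tangent_space S (x, f x) = {w. mink w (normal x) = 0}"
proof -
  have "sqrt (1 - grad f x \<bullet> grad f x) \<noteq> 0" using grad_square[of x] by simp
  then have "mink w (normal x) = 0 \<longleftrightarrow> grad f x \<bullet> fst w = snd w" for w
    by (simp add: normal_def mink.scaleR_right) (simp add: mink_def inner_commute)
  then show ?thesis
    unfolding tangent_space_graph[OF smooth S_eq] by (auto simp: prod_eq_iff)
qed

text \<open>A second candidate for the normal is orthogonal to the tangent hyperplane, hence a multiple of
  the first; the normalisation and the time orientation fix the factor to \<open>1\<close>.\<close>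

lemma unit_normal_graph: "unit_normal S (x, f x) = normal x"
  unfolding unit_normal_def
proof (rule the_equality)
  show "(\<forall>v\<in>tangent_space S (x, f x). mink (normal x) v = 0) \<and> mink (normal x) (normal x) = - 1 \<and>
    future_directed (normal x)"
    by (auto simp: tangent_space_normal mink_commute normal_unit normal_future future_directed_def)
  fix \<nu> assume \<nu>: "(\<forall>v\<in>tangent_space S (x, f x). mink \<nu> v = 0) \<and> mink \<nu> \<nu> = - 1 \<and> future_directed \<nu>"
  define k where "k = - mink \<nu> (normal x)"
  have eq: "\<nu> = k *\<^sub>R normal x"
    unfolding k_def using \<nu>
    by (intro orthogonal_to_hyperplane normal_unit) (auto simp: tangent_space_normal)
  have "k * snd (normal x) > 0" using \<nu> eq unfolding future_directed_def by (metis snd_scaleR real_scaleR_def)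
  then have "k > 0" using normal_future[of x] by (simp add: zero_less_mult_iff)
  moreover have "k * k = 1"
    using \<nu> normal_unit[of x] unfolding eq by (simp add: mink.scaleR_left mink.scaleR_right)
  ultimately have "k = 1" by (simp add: square_eq_1_iff)
  then show "\<nu> = normal x" using eq by simp
qed

lemma differentiable_normal: "normal differentiable (at x)"
proof -
  obtain G where G: "(grad f has_derivative G) (at x)"
    using differentiable_grad[OF smooth] unfolding differentiable_def by blast
  have "((\<lambda>x. 1 - grad f x \<bullet> grad f x) has_derivative (\<lambda>h. 0 - (grad f x \<bullet> G h + G h \<bullet> grad f x))) (at x)"
    by (intro derivative_intros has_derivative_const G)
  then have "(\<lambda>x. sqrt (1 - grad f x \<bullet> grad f x)) differentiable (at x)"
    using grad_square[of x] has_derivative_real_sqrt[of "\<lambda>x. 1 - grad f x \<bullet> grad f x" x]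
    unfolding differentiable_def by fastforce
  then have "(\<lambda>x. inverse (sqrt (1 - grad f x \<bullet> grad f x))) differentiable (at x)"
    using grad_square[of x] by (intro differentiable_inverse) auto
  moreover have "(\<lambda>x. (grad f x, 1::real)) differentiable (at x)"
    using has_derivative_Pair[OF G has_derivative_const] unfolding differentiable_def by blast
  ultimately show ?thesis
    unfolding normal_def by (intro differentiable_scaleR)
qed

lemma Lipschitz_strict: "x \<noteq> y \<Longrightarrow> \<bar>f x - f y\<bar> < norm (x - y)"
proof -
  assume xy: "x \<noteq> y"
  have "\<exists>t\<in>{0<..<1}. f (y + 1 *\<^sub>R (x - y)) - f (y + 0 *\<^sub>R (x - y)) = (1 - 0) * (grad f (y + t *\<^sub>R (x - y)) \<bullet> (x - y))"
  proof -
    have d: "((\<lambda>t. f (y + t *\<^sub>R (x - y))) has_real_derivative grad f (y + t *\<^sub>R (x - y)) \<bullet> (x - y)) (at t)" for t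
    proof -
      have "((\<lambda>t. y + t *\<^sub>R (x - y)) has_derivative (\<lambda>h. h *\<^sub>R (x - y))) (at t)"
        by (auto intro!: derivative_eq_intros)
      from has_derivative_compose[OF this has_derivative_grad[OF smooth]]
      show ?thesis by (simp add: has_field_derivative_def mult_commute_abs)
    qed
    show ?thesis using MVT2[of 0 1, OF _ d] by (metis greaterThanLessThan_iff zero_less_one)
  qed
  then obtain t where t: "f x - f y = grad f (y + t *\<^sub>R (x - y)) \<bullet> (x - y)" by auto
  have "\<bar>f x - f y\<bar> \<le> norm (grad f (y + t *\<^sub>R (x - y))) * norm (x - y)"
    unfolding t by (rule Cauchy_Schwarz_ineq2)
  also have "\<dots> < 1 * norm (x - y)"
    using norm_grad xy by (intro mult_strict_right_mono) auto
  finally show ?thesis by simp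
qed

lemma continuous_f: "continuous_on A f"
  by (intro continuous_at_imp_continuous_on ballI
      has_derivative_continuous[OF has_derivative_grad[OF smooth]])

lemma closed_S: "closed S"
proof -
  have "S = {p. snd p = f (fst p)}" by (auto simp: S_eq)
  moreover have "closed {p :: 'n minkowski. snd p = f (fst p)}"
    by (intro closed_Collect_eq continuous_intros continuous_on_compose2[OF continuous_f]) auto
  ultimately show ?thesis by simp
qed

text \<open>Differentiating \<open>\<langle>c', \<nu>\<rangle> = 0\<close> along a curve \<open>c\<close> in the hypersurface expresses the second
  fundamental form \<open>h v = \<langle>v, d\<nu> v\<rangle>\<close> through the acceleration of a curve with velocity \<open>v\<close>.\<close>

lemma second_fundamental_form:
  assumes p: "p \<in> S"
  obtains \<nu> h where "second_form_at S p \<nu> h"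
    "\<And>e. mink_frame \<nu> e \<Longrightarrow> (\<Sum>i\<in>UNIV. h (e i)) = real CARD('n) * mean_curvature S p"
proof -
  obtain x where px: "p = (x, f x)" using p S_eq by auto
  define \<nu> where "\<nu> = normal x"
  have \<nu>: "mink \<nu> \<nu> = -1" "snd \<nu> > 0" by (simp_all add: \<nu>_def normal_unit normal_future)
  have T: "tangent_space S p = {w. mink w \<nu> = 0}" by (simp add: px tangent_space_normal \<nu>_def)
  define A where "A = frechet_derivative (unit_normal S) (at p within S)"
  obtain N' where N': "(normal has_derivative N') (at x)"
    using differentiable_normal unfolding differentiable_def by blast
  have "((\<lambda>q. normal (fst q)) has_derivative (\<lambda>h. N' (fst h))) (at p within S)"
    by (rule has_derivative_compose[OF has_derivative_fst[OF has_derivative_ident]])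
      (use N' px in simp)
  then have "(unit_normal S has_derivative (\<lambda>h. N' (fst h))) (at p within S)"
    by (rule has_derivative_transform[OF p, rotated]) (use S_eq unit_normal_graph in fastforce)
  then have dA: "(unit_normal S has_derivative A) (at p within S)"
    unfolding A_def using frechet_derivative_works differentiableI by blast
  have curve: "\<exists>c c' k. range c \<subseteq> S \<and> c 0 = p \<and>
       (\<forall>s. (c has_vector_derivative c' s) (at s)) \<and> c' 0 = v \<and>
       (c' has_vector_derivative k) (at 0) \<and> mink k \<nu> = - mink v (A v) \<and> mink (A v) \<nu> = 0"
    if v: "mink v \<nu> = 0" for v
  proof -
    obtain a where a: "v = (a, grad f x \<bullet> a)"
      using v T tangent_space_graph[OF smooth S_eq, of x] px by auto
    define c where "c = (\<lambda>s::real. (x + s *\<^sub>R a, f (x + s *\<^sub>R a)))"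
    define c' where "c' = (\<lambda>s::real. (a, grad f (x + s *\<^sub>R a) \<bullet> a))"
    have l: "((\<lambda>s. x + s *\<^sub>R a) has_derivative (\<lambda>h. h *\<^sub>R a)) (at s)" for s :: real
      by (auto intro!: derivative_eq_intros)
    have dc: "(c has_vector_derivative c' s) (at s)" for s
      using has_derivative_Pair[OF l has_derivative_compose[OF l has_derivative_grad[OF smooth]]]
      by (simp add: c_def c'_def has_vector_derivative_def)
    obtain G where G: "(grad f has_derivative G) (at x)"
      using differentiable_grad[OF smooth] unfolding differentiable_def by blast
    have "((\<lambda>s. grad f (x + s *\<^sub>R a)) has_derivative (\<lambda>h. G (h *\<^sub>R a))) (at 0)"
      by (rule has_derivative_compose[OF l]) (use G in simp)
    then have "((\<lambda>s. grad f (x + s *\<^sub>R a) \<bullet> a) has_derivative (\<lambda>h. G (h *\<^sub>R a) \<bullet> a)) (at 0)"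
      by (rule has_derivative_inner_left)
    from has_derivative_Pair[OF has_derivative_const this]
    have dc': "(c' has_vector_derivative (0, G a \<bullet> a)) (at 0)"
      using linear_scale[OF has_derivative_linear[OF G]]
      by (simp add: c'_def has_vector_derivative_def)
    have c0: "c 0 = p" "c' 0 = v" by (simp_all add: c_def c'_def px a)
    have cS: "range c \<subseteq> S" by (auto simp: c_def S_eq)
    define n where "n s = unit_normal S (c s)" for s
    have n_eq: "n s = normal (x + s *\<^sub>R a)" for s by (simp add: n_def c_def unit_normal_graph)
    have "(n has_derivative (\<lambda>h. A (h *\<^sub>R v))) (at 0 within UNIV)"
      unfolding n_def
      using has_derivative_in_compose[of c "\<lambda>h. h *\<^sub>R v" 0 UNIV "unit_normal S" A]
        has_derivative_subset[OF dA cS] dc[of 0] c0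
      by (simp add: has_vector_derivative_def)
    then have dn: "(n has_vector_derivative A v) (at 0)"
      using linear_scale[OF has_derivative_linear[OF dA]] by (simp add: has_vector_derivative_def)
    have n0: "n 0 = \<nu>" by (simp add: n_eq \<nu>_def)
    have "((\<lambda>s. mink (c' s) (n s)) has_vector_derivative mink (c' 0) (A v) + mink (0, G a \<bullet> a) (n 0)) (at 0)"
      by (rule mink.has_vector_derivative[OF dc' dn])
    moreover have "mink (c' s) (n s) = 0" for s
      using tangent_space_normal[of "x + s *\<^sub>R a"] tangent_space_graph[OF smooth S_eq, of "x + s *\<^sub>R a"]
      by (auto simp: c'_def n_eq)
    ultimately have "mink v (A v) + mink (0, G a \<bullet> a) \<nu> = 0"
      using vector_derivative_unique_at[of "\<lambda>s. 0" _ 0 0] by (simp add: c0 n0)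
    moreover have "((\<lambda>s. mink (n s) (n s)) has_vector_derivative mink (n 0) (A v) + mink (A v) (n 0)) (at 0)"
      by (rule mink.has_vector_derivative[OF dn dn])
    then have "((\<lambda>s. -1) has_vector_derivative 2 * mink (A v) \<nu>) (at 0)"
      by (simp add: n_eq normal_unit n0 mink_commute[of "normal x" "A v"] \<nu>_def)
    then have "mink (A v) \<nu> = 0"
      using vector_derivative_unique_at[OF has_vector_derivative_const] by fastforce
    ultimately show ?thesis
      using cS c0 dc dc' by (intro exI[of _ c] exI[of _ c'] exI[of _ "(0, G a \<bullet> a)"]) auto
  qed
  have lin: "linear A" by (rule has_derivative_linear[OF dA])
  show ?thesis
  proof (rule that[of \<nu> "\<lambda>v. mink v (A v)"])
    show "second_form_at S p \<nu> (\<lambda>v. mink v (A v))"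
      unfolding second_form_at_def
      using \<nu> curve by (auto simp: linear_scale[OF lin] mink_simps power2_eq_square) blast
    fix e :: "'n \<Rightarrow> 'n minkowski" assume e: "mink_frame \<nu> e"
    have "trace_on (tangent_space S p) A = (\<Sum>i\<in>UNIV. mink (A (e i)) (e i))"
      by (rule trace_on_frame[OF T lin _ e]) (use curve T in blast)
    then show "(\<Sum>i\<in>UNIV. mink (e i) (A (e i))) = real CARD('n) * mean_curvature S p"
      by (simp add: mean_curvature_def A_def[symmetric] mink_commute)
  qed
qed

end

section \<open>Two hypersurfaces at maximal separation\<close>

text \<open>The second derivative is taken at the maximum only, because \<open>second_form_at\<close> provides curves
  with an acceleration at their base point.\<close>

lemma second_derivative_test:
  fixes g :: "real \<Rightarrow> real"
  assumes g: "\<And>s. (g has_real_derivative g' s) (at s)" and g': "(g' has_real_derivative k) (at 0)"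
    and max: "eventually (\<lambda>s. g s \<le> g 0) (nhds 0)"
  shows "g' 0 = 0" "k \<le> 0"
proof -
  obtain d where d: "d > 0" "\<And>s. \<bar>s\<bar> < d \<Longrightarrow> g s \<le> g 0"
    using max by (auto simp: eventually_nhds_metric dist_real_def)
  show g0: "g' 0 = 0"
    by (rule DERIV_local_max[OF g d(1)]) (use d(2) in auto)
  show "k \<le> 0"
  proof (rule ccontr)
    assume "\<not> k \<le> 0"
    then obtain d' where d': "d' > 0" "\<And>h. 0 < h \<Longrightarrow> h < d' \<Longrightarrow> 0 < g' h"
      using DERIV_pos_inc_right[OF g'] g0 by auto
    define b where "b = min d d' / 2"
    have b: "0 < b" "b < d" "b < d'" using d(1) d'(1) by (auto simp: b_def)
    have "g 0 < g b"
    proof (rule DERIV_pos_imp_increasing_open[OF b(1)])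
      show "\<exists>y. (g has_real_derivative y) (at x) \<and> 0 < y" if "0 < x" "x < b" for x
        using g[of x] d'(2)[of x] that b by auto
      show "continuous_on {0..b} g"
        using g by (auto intro!: continuous_at_imp_continuous_on DERIV_isCont)
    qed
    then show False using d(2)[of b] b by simp
  qed
qed

text \<open>Half the squared Lorentzian distance from \<open>q\<close> to \<open>p\<close>, minus a penalty that keeps both
  points near \<open>p\<^sub>0\<close> and \<open>q\<^sub>0\<close>. A quadratic function is used rather than the distance itself since
  its second derivative is constant.\<close>

definition separation ::
  "'n::finite minkowski \<Rightarrow> real \<Rightarrow> 'n minkowski \<Rightarrow> 'n minkowski \<Rightarrow> 'n minkowski \<Rightarrow> 'n minkowski \<Rightarrow> real" where
  "separation N \<epsilon> p\<^sub>0 q\<^sub>0 p q =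
     - mink (p - q) (p - q) / 2 - \<epsilon> / 2 * (observer N (p - p\<^sub>0) (p - p\<^sub>0) + observer N (q - q\<^sub>0) (q - q\<^sub>0))"

text \<open>First and second variation of the separation along a pair of curves. The accelerations enter
  only through their products with \<open>V\<^sub>1\<close> and \<open>V\<^sub>2\<close>, which are up to sign the Lorentzian gradients of the
  separation in its two arguments.\<close>

lemma separation_variation:
  fixes N p\<^sub>0 q\<^sub>0 :: "'n::finite minkowski" and P Q :: "real \<Rightarrow> 'n minkowski"
  assumes P: "\<And>s. (P has_vector_derivative P' s) (at s)" "(P' has_vector_derivative a) (at 0)"
    and Q: "\<And>s. (Q has_vector_derivative Q' s) (at s)" "(Q' has_vector_derivative b) (at 0)"
    and max: "eventually (\<lambda>s. separation N \<epsilon> p\<^sub>0 q\<^sub>0 (P s) (Q s) \<le> separation N \<epsilon> p\<^sub>0 q\<^sub>0 (P 0) (Q 0)) (nhds 0)"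
  defines "V\<^sub>1 \<equiv> P 0 - Q 0 + \<epsilon> *\<^sub>R reflect N (P 0 - p\<^sub>0)"
    and "V\<^sub>2 \<equiv> P 0 - Q 0 - \<epsilon> *\<^sub>R reflect N (Q 0 - q\<^sub>0)"
  shows "mink V\<^sub>1 (P' 0) = mink V\<^sub>2 (Q' 0)"
    "mink V\<^sub>2 b - mink V\<^sub>1 a \<le>
      mink (P' 0 - Q' 0) (P' 0 - Q' 0) + \<epsilon> * (observer N (P' 0) (P' 0) + observer N (Q' 0) (Q' 0))"
proof -
  define g' where "g' s = - mink (P s - Q s) (P' s - Q' s)
     - \<epsilon> * (observer N (P s - p\<^sub>0) (P' s) + observer N (Q s - q\<^sub>0) (Q' s))" for s
  define k where "k = - (mink (P 0 - Q 0) (a - b) + mink (P' 0 - Q' 0) (P' 0 - Q' 0))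
     - \<epsilon> * ((observer N (P 0 - p\<^sub>0) a + observer N (P' 0) (P' 0)) + (observer N (Q 0 - q\<^sub>0) b + observer N (Q' 0) (Q' 0)))"
  have shift: "((\<lambda>s. u s - c) has_vector_derivative u') (at s)" if "(u has_vector_derivative u') (at s)"
    for u u' s and c :: "'n minkowski"
    using has_vector_derivative_diff[OF that has_vector_derivative_const] by simp
  have DP: "((\<lambda>s. P s - p\<^sub>0) has_vector_derivative P' s) (at s)"
    and DQ: "((\<lambda>s. Q s - q\<^sub>0) has_vector_derivative Q' s) (at s)" for s
    by (rule shift P Q)+
  have D: "((\<lambda>s. P s - Q s) has_vector_derivative P' s - Q' s) (at s)" for s
    by (intro has_vector_derivative_diff P Q)
  have D': "((\<lambda>s. P' s - Q' s) has_vector_derivative a - b) (at 0)"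
    by (intro has_vector_derivative_diff P Q)
  have sq: "((\<lambda>s. mink (P s - Q s) (P s - Q s)) has_real_derivative 2 * mink (P s - Q s) (P' s - Q' s)) (at s)"
    "((\<lambda>s. observer N (P s - p\<^sub>0) (P s - p\<^sub>0)) has_real_derivative 2 * observer N (P s - p\<^sub>0) (P' s)) (at s)"
    "((\<lambda>s. observer N (Q s - q\<^sub>0) (Q s - q\<^sub>0)) has_real_derivative 2 * observer N (Q s - q\<^sub>0) (Q' s)) (at s)" for s
    using mink.has_vector_derivative[OF D[of s] D[of s]]
      observer.has_vector_derivative[where N = N, OF DP[of s] DP[of s]]
      observer.has_vector_derivative[where N = N, OF DQ[of s] DQ[of s]]
    by (simp_all add: has_real_derivative_iff_has_vector_derivative
        mink_commute[of "P' s - Q' s"] observer_commute[of N "P' s"] observer_commute[of N "Q' s"])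
  have dg: "((\<lambda>s. separation N \<epsilon> p\<^sub>0 q\<^sub>0 (P s) (Q s)) has_real_derivative g' s) (at s)" for s
    unfolding separation_def g'_def
    by (rule DERIV_cong[OF DERIV_diff[OF DERIV_cdivide[OF DERIV_minus[OF sq(1)]]
          DERIV_cmult[OF DERIV_add[OF sq(2) sq(3)]]]]) (simp add: algebra_simps)
  have sq': "((\<lambda>s. mink (P s - Q s) (P' s - Q' s)) has_real_derivative mink (P 0 - Q 0) (a - b) + mink (P' 0 - Q' 0) (P' 0 - Q' 0)) (at 0)"
    "((\<lambda>s. observer N (P s - p\<^sub>0) (P' s)) has_real_derivative observer N (P 0 - p\<^sub>0) a + observer N (P' 0) (P' 0)) (at 0)"
    "((\<lambda>s. observer N (Q s - q\<^sub>0) (Q' s)) has_real_derivative observer N (Q 0 - q\<^sub>0) b + observer N (Q' 0) (Q' 0)) (at 0)"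
    using mink.has_vector_derivative[OF D D']
      observer.has_vector_derivative[OF DP P(2)] observer.has_vector_derivative[OF DQ Q(2)]
    by (simp_all add: has_real_derivative_iff_has_vector_derivative)
  have dg': "(g' has_real_derivative k) (at 0)"
    unfolding g'_def[abs_def] k_def
    by (rule DERIV_diff[OF DERIV_minus[OF sq'(1)] DERIV_cmult[OF DERIV_add[OF sq'(2) sq'(3)]]])
  have "g' 0 = 0" "k \<le> 0"
    using second_derivative_test[OF dg dg' max] by auto
  then show "mink V\<^sub>1 (P' 0) = mink V\<^sub>2 (Q' 0)"
    "mink V\<^sub>2 b - mink V\<^sub>1 a \<le>
      mink (P' 0 - Q' 0) (P' 0 - Q' 0) + \<epsilon> * (observer N (P' 0) (P' 0) + observer N (Q' 0) (Q' 0))"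
    by (simp_all add: g'_def k_def V\<^sub>1_def V\<^sub>2_def observer_commute[of N "P 0 - p\<^sub>0"] observer_commute[of N "Q 0 - q\<^sub>0"])
      (simp_all add: observer_def mink_simps mink_commute algebra_simps)
qed

lemma second_form_atD:
  assumes "second_form_at S p \<nu> h"
  shows "mink \<nu> \<nu> = -1" "snd \<nu> > 0" "h (t *\<^sub>R v) = t\<^sup>2 * h v"
  using assms unfolding second_form_at_def by blast+

lemma second_form_at_curve:
  assumes "second_form_at S p \<nu> h" "mink v \<nu> = 0"
  obtains c c' k where "range c \<subseteq> S" "c 0 = p" "\<And>s. (c has_vector_derivative c' s) (at s)" "c' 0 = v"
    "(c' has_vector_derivative k) (at 0)" "mink k \<nu> = - h v"
  using assms unfolding second_form_at_def by metis

lemma eventually_curve_in_open: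
  assumes "\<And>s. (c has_vector_derivative c' s) (at s)" "open W" "c (0::real) \<in> W"
  shows "eventually (\<lambda>s. c s \<in> W) (nhds 0)"
proof -
  have "isCont c 0" using assms(1) has_vector_derivative_continuous by blast
  then have "eventually (\<lambda>s. c s \<in> W) (at 0)"
    using assms(2,3) unfolding isCont_def by (rule topological_tendstoD)
  then show ?thesis using assms(3) by (simp add: eventually_nhds_conv_at)
qed

text \<open>At a local maximum over pairs of points the gradients \<open>V\<^sub>1\<close> and \<open>V\<^sub>2\<close> are normal to the respective
  hypersurfaces, so the second variation involves the accelerations only through the second
  fundamental forms.\<close>

lemma separation_maximum:
  assumes 1: "second_form_at S\<^sub>1 p \<nu>\<^sub>1 h\<^sub>1" and 2: "second_form_at S\<^sub>2 q \<nu>\<^sub>2 h\<^sub>2"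
    and W: "open W" "(p, q) \<in> W"
    and max: "\<And>p' q'. p' \<in> S\<^sub>1 \<Longrightarrow> q' \<in> S\<^sub>2 \<Longrightarrow> (p', q') \<in> W \<Longrightarrow>
       separation N \<epsilon> p\<^sub>0 q\<^sub>0 p' q' \<le> separation N \<epsilon> p\<^sub>0 q\<^sub>0 p q"
  defines "V\<^sub>1 \<equiv> p - q + \<epsilon> *\<^sub>R reflect N (p - p\<^sub>0)" and "V\<^sub>2 \<equiv> p - q - \<epsilon> *\<^sub>R reflect N (q - q\<^sub>0)"
  obtains c\<^sub>1 c\<^sub>2 where "V\<^sub>1 = c\<^sub>1 *\<^sub>R \<nu>\<^sub>1" "V\<^sub>2 = c\<^sub>2 *\<^sub>R \<nu>\<^sub>2"
    "\<And>v w. mink v \<nu>\<^sub>1 = 0 \<Longrightarrow> mink w \<nu>\<^sub>2 = 0 \<Longrightarrow>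
       c\<^sub>1 * h\<^sub>1 v - c\<^sub>2 * h\<^sub>2 w \<le> mink (v - w) (v - w) + \<epsilon> * (observer N v v + observer N w w)"
proof -
  have var: "mink V\<^sub>1 v = mink V\<^sub>2 w \<and> (\<exists>a b. mink a \<nu>\<^sub>1 = - h\<^sub>1 v \<and> mink b \<nu>\<^sub>2 = - h\<^sub>2 w \<and>
      mink V\<^sub>2 b - mink V\<^sub>1 a \<le> mink (v - w) (v - w) + \<epsilon> * (observer N v v + observer N w w))"
    if v: "mink v \<nu>\<^sub>1 = 0" and w: "mink w \<nu>\<^sub>2 = 0" for v w
  proof -
    obtain P P' a where P: "range P \<subseteq> S\<^sub>1" "P 0 = p" "\<And>s. (P has_vector_derivative P' s) (at s)" "P' 0 = v"
      "(P' has_vector_derivative a) (at 0)" "mink a \<nu>\<^sub>1 = - h\<^sub>1 v"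
      using second_form_at_curve[OF 1 v] by metis
    obtain Q Q' b where Q: "range Q \<subseteq> S\<^sub>2" "Q 0 = q" "\<And>s. (Q has_vector_derivative Q' s) (at s)" "Q' 0 = w"
      "(Q' has_vector_derivative b) (at 0)" "mink b \<nu>\<^sub>2 = - h\<^sub>2 w"
      using second_form_at_curve[OF 2 w] by metis
    have "((\<lambda>s. (P s, Q s)) has_vector_derivative (P' s, Q' s)) (at s)" for s
      using P(3) Q(3) by (rule has_vector_derivative_Pair)
    then have "eventually (\<lambda>s. (P s, Q s) \<in> W) (nhds 0)"
      by (rule eventually_curve_in_open) (use W P Q in auto)
    then have "eventually (\<lambda>s. separation N \<epsilon> p\<^sub>0 q\<^sub>0 (P s) (Q s) \<le> separation N \<epsilon> p\<^sub>0 q\<^sub>0 (P 0) (Q 0)) (nhds 0)"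
      unfolding P(2) Q(2) by (rule eventually_mono) (use max P(1) Q(1) in blast)
    from separation_variation[OF P(3,5) Q(3,5) this] show ?thesis
      using P(6) Q(6) unfolding P(2,4) Q(2,4) V\<^sub>1_def V\<^sub>2_def by blast
  qed
  define c\<^sub>1 c\<^sub>2 where "c\<^sub>1 = - mink V\<^sub>1 \<nu>\<^sub>1" and "c\<^sub>2 = - mink V\<^sub>2 \<nu>\<^sub>2"
  have V\<^sub>1: "V\<^sub>1 = c\<^sub>1 *\<^sub>R \<nu>\<^sub>1"
    unfolding c\<^sub>1_def using var[of _ 0] by (intro orthogonal_to_hyperplane second_form_atD[OF 1]) (auto simp: mink.zero_left mink.zero_right)
  have V\<^sub>2: "V\<^sub>2 = c\<^sub>2 *\<^sub>R \<nu>\<^sub>2"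
    unfolding c\<^sub>2_def using var[of 0] by (intro orthogonal_to_hyperplane second_form_atD[OF 2]) (auto simp: mink.zero_left mink.zero_right)
  show ?thesis
  proof (rule that[OF V\<^sub>1 V\<^sub>2])
    fix v w assume "mink v \<nu>\<^sub>1 = 0" "mink w \<nu>\<^sub>2 = 0"
    then obtain a b where a: "mink a \<nu>\<^sub>1 = - h\<^sub>1 v" and b: "mink b \<nu>\<^sub>2 = - h\<^sub>2 w"
      and le: "mink V\<^sub>2 b - mink V\<^sub>1 a \<le> mink (v - w) (v - w) + \<epsilon> * (observer N v v + observer N w w)"
      using var by blast
    have "mink V\<^sub>1 a = - c\<^sub>1 * h\<^sub>1 v"
      unfolding V\<^sub>1 mink.scaleR_left mink_commute[of \<nu>\<^sub>1 a] a by simp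
    moreover have "mink V\<^sub>2 b = - c\<^sub>2 * h\<^sub>2 w"
      unfolding V\<^sub>2 mink.scaleR_left mink_commute[of \<nu>\<^sub>2 b] b by simp
    ultimately show "c\<^sub>1 * h\<^sub>1 v - c\<^sub>2 * h\<^sub>2 w \<le> mink (v - w) (v - w) + \<epsilon> * (observer N v v + observer N w w)"
      using le by simp
  qed
qed

text \<open>Moving \<open>q\<close> along \<open>e\<^sub>i\<close> and \<open>p\<close> along \<open>\<mu>\<close> times the boost of \<open>e\<^sub>i\<close> and summing over \<open>i\<close> gives mean
  curvatures. The factor \<open>\<mu> > 1\<close> is essential: it multiplies the positive curvature of the upper
  hypersurface by \<open>\<mu>\<^sup>2\<close> at a cost of only \<open>(\<mu> - 1)\<^sup>2\<close>, so for \<open>\<mu>\<close> close to \<open>1\<close> it turns the weak inequality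
  between the two curvature bounds into a strict one.\<close>

lemma traced_second_variation:
  fixes \<nu>\<^sub>1 \<nu>\<^sub>2 N :: "'n::finite minkowski"
  assumes 1: "second_form_at S\<^sub>1 p \<nu>\<^sub>1 h\<^sub>1" and 2: "second_form_at S\<^sub>2 q \<nu>\<^sub>2 h\<^sub>2"
    and m1: "\<And>e. mink_frame \<nu>\<^sub>1 e \<Longrightarrow> (\<Sum>i\<in>UNIV. h\<^sub>1 (e i)) = real CARD('n) * m\<^sub>1"
    and m2: "\<And>e. mink_frame \<nu>\<^sub>2 e \<Longrightarrow> (\<Sum>i\<in>UNIV. h\<^sub>2 (e i)) = real CARD('n) * m\<^sub>2"
    and le: "\<And>v w. mink v \<nu>\<^sub>1 = 0 \<Longrightarrow> mink w \<nu>\<^sub>2 = 0 \<Longrightarrow>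
       c\<^sub>1 * h\<^sub>1 v - c\<^sub>2 * h\<^sub>2 w \<le> mink (v - w) (v - w) + \<epsilon> * (observer N v v + observer N w w)"
    and N: "mink N N = -1" and N1: "(mink N \<nu>\<^sub>1)\<^sup>2 \<le> 4" and N2: "(mink N \<nu>\<^sub>2)\<^sup>2 \<le> 4"
    and \<epsilon>: "0 \<le> \<epsilon>" and \<mu>: "0 \<le> \<mu>"
  shows "\<mu>\<^sup>2 * (c\<^sub>1 * m\<^sub>1) - c\<^sub>2 * m\<^sub>2 \<le> (\<mu> - 1)\<^sup>2 + 7 * \<epsilon> * (\<mu>\<^sup>2 + 1)"
proof -
  note \<nu>\<^sub>1 = second_form_atD[OF 1] and \<nu>\<^sub>2 = second_form_atD[OF 2]
  \<comment> \<open>Move \<open>q\<close> along a frame of its tangent space and \<open>p\<close> along \<open>\<mu>\<close> times the boosted frame.\<close>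
  have neg: "mink \<nu>\<^sub>1 \<nu>\<^sub>2 < 0" by (rule mink_future_timelike_neg) (use \<nu>\<^sub>1 \<nu>\<^sub>2 in auto)
  obtain e where e: "mink_frame \<nu>\<^sub>2 e" using mink_frame_exists[OF \<nu>\<^sub>2(1,2)] by blast
  define b where "b i = boost \<nu>\<^sub>1 \<nu>\<^sub>2 (e i)" for i
  have b: "mink_frame \<nu>\<^sub>1 b" unfolding b_def by (rule mink_frame_boost[OF \<nu>\<^sub>1(1) \<nu>\<^sub>2(1) neg e])
  define n where "n = real CARD('n)"
  have "c\<^sub>1 * (\<mu>\<^sup>2 * h\<^sub>1 (b i)) - c\<^sub>2 * h\<^sub>2 (e i) \<le>
      (\<mu> - 1)\<^sup>2 + \<epsilon> * (\<mu>\<^sup>2 * observer N (b i) (b i) + observer N (e i) (e i))" for i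
  proof -
    have ei: "mink (e i) \<nu>\<^sub>2 = 0" "mink (e i) (e i) = 1" and bi: "mink (b i) \<nu>\<^sub>1 = 0" "mink (b i) (b i) = 1"
      using e b by (auto simp: mink_frame_def)
    have "1 \<le> mink (e i) (b i)"
      unfolding b_def ei(2)[symmetric] by (rule boost_expands[OF \<nu>\<^sub>1(1) \<nu>\<^sub>2(1) neg ei(1)])
    then have "\<mu> * 1 \<le> \<mu> * mink (e i) (b i)" using \<mu> by (intro mult_left_mono)
    then have "mink (\<mu> *\<^sub>R b i - e i) (\<mu> *\<^sub>R b i - e i) \<le> (\<mu> - 1)\<^sup>2"
      by (simp add: mink_simps ei bi mink_commute[of "b i" "e i"] power2_eq_square algebra_simps)
    moreover have "mink (\<mu> *\<^sub>R b i) \<nu>\<^sub>1 = 0" by (simp add: mink.scaleR_left bi)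
    from le[OF this ei(1)] have "c\<^sub>1 * (\<mu>\<^sup>2 * h\<^sub>1 (b i)) - c\<^sub>2 * h\<^sub>2 (e i) \<le>
      mink (\<mu> *\<^sub>R b i - e i) (\<mu> *\<^sub>R b i - e i) + \<epsilon> * (\<mu>\<^sup>2 * observer N (b i) (b i) + observer N (e i) (e i))"
      by (simp add: \<nu>\<^sub>1(3) observer_simps power2_eq_square mult.assoc)
    ultimately show ?thesis by linarith
  qed
  then have "(\<Sum>i\<in>UNIV. c\<^sub>1 * (\<mu>\<^sup>2 * h\<^sub>1 (b i)) - c\<^sub>2 * h\<^sub>2 (e i)) \<le>
      (\<Sum>i\<in>UNIV. (\<mu> - 1)\<^sup>2 + \<epsilon> * (\<mu>\<^sup>2 * observer N (b i) (b i) + observer N (e i) (e i)))"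
    by (rule sum_mono)
  also have "\<dots> = n * (\<mu> - 1)\<^sup>2 +
      \<epsilon> * (\<mu>\<^sup>2 * (\<Sum>i\<in>UNIV. observer N (b i) (b i)) + (\<Sum>i\<in>UNIV. observer N (e i) (e i)))"
    unfolding n_def sum.distrib sum_distrib_left[symmetric] by simp
  also have "\<dots> \<le> n * (\<mu> - 1)\<^sup>2 + \<epsilon> * (\<mu>\<^sup>2 * (7 * n) + 7 * n)"
    using mink_frame_observer_sum[OF b \<nu>\<^sub>1(1) N N1] mink_frame_observer_sum[OF e \<nu>\<^sub>2(1) N N2] \<epsilon>
    by (intro add_mono order_refl mult_left_mono) (simp_all add: n_def)
  also have "(\<Sum>i\<in>UNIV. c\<^sub>1 * (\<mu>\<^sup>2 * h\<^sub>1 (b i)) - c\<^sub>2 * h\<^sub>2 (e i)) =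
      c\<^sub>1 * \<mu>\<^sup>2 * (\<Sum>i\<in>UNIV. h\<^sub>1 (b i)) - c\<^sub>2 * (\<Sum>i\<in>UNIV. h\<^sub>2 (e i))"
    by (simp add: sum_subtractf sum_distrib_left mult.assoc)
  finally have "n * (\<mu>\<^sup>2 * (c\<^sub>1 * m\<^sub>1) - c\<^sub>2 * m\<^sub>2) \<le> n * ((\<mu> - 1)\<^sup>2 + 7 * \<epsilon> * (\<mu>\<^sup>2 + 1))"
    by (simp add: m1[OF b] m2[OF e] n_def[symmetric] algebra_simps)
  then show ?thesis by (simp add: n_def)
qed

text \<open>Small and large are measured by the observer \<open>N\<close>, so the bounds do not degenerate when \<open>N\<close> is
  nearly null in the given coordinates.\<close>

lemma near_timelike_multiple:
  assumes N: "mink N N = -1" "snd N > 0" and \<nu>: "mink \<nu> \<nu> = -1" "snd \<nu> > 0"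
    and V: "s *\<^sub>R N + Y = c *\<^sub>R \<nu>" and Y: "observer N Y Y \<le> y\<^sup>2" and y: "0 < y" "5 * y \<le> s"
  shows "s - 2 * y \<le> c" "c \<le> s + y" "(mink N \<nu>)\<^sup>2 \<le> 4"
proof -
  have NN: "observer N N N = 1" by (simp add: observer_alt N)
  have "(mink N Y)\<^sup>2 \<le> y\<^sup>2"
    using mink_observer_Cauchy_Schwarz[OF N(1), of N Y] Y by (simp add: NN)
  then have NY: "\<bar>mink N Y\<bar> \<le> y" using y by (simp add: abs_le_square_iff[symmetric])
  have "(mink Y Y)\<^sup>2 \<le> (observer N Y Y)\<^sup>2"
    using mink_observer_Cauchy_Schwarz[OF N(1), of Y Y] by (simp add: power2_eq_square)
  then have YY: "\<bar>mink Y Y\<bar> \<le> y\<^sup>2"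
    using observer_nonneg[OF N(1), of Y] Y by (simp add: abs_le_square_iff[symmetric])
  have neg: "mink N \<nu> < 0" by (rule mink_future_timelike_neg) (use N \<nu> in auto)
  have cN: "c * mink N \<nu> = - s + mink N Y"
    using arg_cong[OF V, of "mink N"] by (simp add: mink_simps N)
  then have "c * mink N \<nu> < 0" using NY y by simp
  then have c: "c > 0" using neg by (simp add: mult_less_0_iff)
  have c2: "c\<^sup>2 = s\<^sup>2 - 2 * s * mink N Y - mink Y Y"
    using arg_cong[OF V, of "\<lambda>u. mink u u"]
    by (simp add: mink_simps N \<nu> mink_commute[of Y N] power2_eq_square algebra_simps)
  have sNY: "\<bar>s * mink N Y\<bar> \<le> s * y"
    using NY y by (simp add: abs_mult mult_left_mono)
  have yy: "5 * (y * y) \<le> s * y" using mult_right_mono[OF y(2), of y] y(1) by simp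
  have "(s - 2 * y)\<^sup>2 \<le> c\<^sup>2"
    unfolding c2 using sNY YY yy by (simp add: power2_eq_square algebra_simps)
  then show lo: "s - 2 * y \<le> c" using c by (rule power2_le_imp_le[OF _ less_imp_le])
  have "c\<^sup>2 \<le> (s + y)\<^sup>2"
    unfolding c2 using sNY YY by (simp add: power2_eq_square algebra_simps)
  then show "c \<le> s + y" by (rule power2_le_imp_le) (use y in simp)
  have "c * (- mink N \<nu>) \<le> c * 2" using cN NY lo y by (simp add: algebra_simps)
  then have "- mink N \<nu> \<le> 2" using mult_le_cancel_left_pos[OF c] by blast
  then have "(- mink N \<nu>)\<^sup>2 \<le> 2\<^sup>2" using neg by (intro power_mono) auto
  then show "(mink N \<nu>)\<^sup>2 \<le> 4" by simp
qed

text \<open>To leading order the inequality \<open>le\<close> reads \<open>2 * \<kappa> * s * H \<le> \<kappa>\<^sup>2\<close>, up to errors governed by \<open>y\<close> and by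
  the penalty \<open>\<kappa>\<^sup>2 / 36\<close>. With \<open>\<kappa> = r * H / 4\<close> the left side is at least \<open>4 * \<kappa>\<^sup>2\<close>; the size of \<open>y\<close> makes the
  errors on the left cost at most half of that, and the penalty adds less than \<open>\<kappa>\<^sup>2\<close> on the right.\<close>

lemma maximal_separation_numeric_contradiction:
  fixes H r s \<kappa> y c\<^sub>1 c\<^sub>2 m\<^sub>1 m\<^sub>2 :: real
  assumes H: "H > 0" and r: "r > 0" "r * H \<le> 1" and s: "r / 2 \<le> s"
    and \<kappa>: "\<kappa> = r * H / 4" and y: "y = \<kappa> * r / 14"
    and c: "s - 2 * y \<le> c\<^sub>1" "0 \<le> c\<^sub>2" "c\<^sub>2 \<le> s + y" and m: "H \<le> m\<^sub>1" "m\<^sub>2 \<le> H"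
    and le: "(1 + \<kappa>)\<^sup>2 * (c\<^sub>1 * m\<^sub>1) - c\<^sub>2 * m\<^sub>2 \<le> \<kappa>\<^sup>2 + 7 * (\<kappa>\<^sup>2 / 36) * ((1 + \<kappa>)\<^sup>2 + 1)"
  shows False
proof -
  have k: "0 < \<kappa>" "\<kappa> \<le> 1 / 4" using H r by (auto simp: \<kappa>)
  have y7: "7 * y \<le> \<kappa> * s" using mult_left_mono[OF s, of \<kappa>] k by (simp add: y)
  have y0: "0 < y" using k r by (simp add: y)
  have sy: "0 < s - 2 * y"
  proof -
    have "\<kappa> * s \<le> 1 / 4 * s" using k r s by (intro mult_right_mono) auto
    then show ?thesis using y7 y0 by linarith
  qed
  have mu: "(1 + \<kappa>)\<^sup>2 \<le> (5 / 4)\<^sup>2" using k by (intro power_mono) auto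
  then have mu': "(1 + \<kappa>)\<^sup>2 \<le> 25 / 16" by (simp add: power2_eq_square)
  have "(s - 2 * y) * H \<le> c\<^sub>1 * m\<^sub>1" using c m H sy by (intro mult_mono) auto
  then have 1: "(1 + \<kappa>)\<^sup>2 * ((s - 2 * y) * H) \<le> (1 + \<kappa>)\<^sup>2 * (c\<^sub>1 * m\<^sub>1)" by (intro mult_left_mono) auto
  have "c\<^sub>2 * m\<^sub>2 \<le> c\<^sub>2 * H" using c m by (intro mult_left_mono)
  also have "\<dots> \<le> (s + y) * H" using c H by (intro mult_right_mono) auto
  finally have 2: "c\<^sub>2 * m\<^sub>2 \<le> (s + y) * H" .
  have "2 * \<kappa>\<^sup>2 = \<kappa> * (r / 2) * H" by (simp add: \<kappa> power2_eq_square)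
  also have "\<dots> \<le> \<kappa> * s * H" using s k H by (intro mult_right_mono mult_left_mono) auto
  also have "\<dots> \<le> (2 * (\<kappa> * s) + \<kappa>\<^sup>2 * s - y * (2 * (1 + \<kappa>)\<^sup>2 + 1)) * H"
  proof (intro mult_right_mono)
    have "y * (2 * (1 + \<kappa>)\<^sup>2 + 1) \<le> y * 7" using mu' y0 by (intro mult_left_mono) auto
    moreover have "0 \<le> \<kappa>\<^sup>2 * s" using s r by simp
    ultimately show "\<kappa> * s \<le> 2 * (\<kappa> * s) + \<kappa>\<^sup>2 * s - y * (2 * (1 + \<kappa>)\<^sup>2 + 1)" using y7 by linarith
  qed (use H in simp)
  also have "\<dots> = (1 + \<kappa>)\<^sup>2 * ((s - 2 * y) * H) - (s + y) * H"
    by (simp add: power2_eq_square algebra_simps)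
  also have "\<dots> \<le> \<kappa>\<^sup>2 + 7 * (\<kappa>\<^sup>2 / 36) * ((1 + \<kappa>)\<^sup>2 + 1)" using 1 2 le by linarith
  also have "\<dots> \<le> \<kappa>\<^sup>2 + 7 * (\<kappa>\<^sup>2 / 36) * (25 / 16 + 1)"
    using mu' by (intro add_left_mono mult_left_mono add_right_mono) auto
  finally have "\<kappa>\<^sup>2 \<le> 0" by simp
  then show False using k by simp
qed

section \<open>The comparison principle\<close>

context spacelike_graph
begin

text \<open>An unbounded part of the hypersurface in the future of \<open>q\<close> would leave room, in a limiting
  direction, for a null ray from \<open>q\<close> that stays strictly below the hypersurface; prolonged
  vertically into the past it is an inextendable causal curve that misses it.\<close>

lemma bounded_future_part:
  assumes q: "(x\<^sub>0, t\<^sub>0) \<in> domain_of_dependence S"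
  shows "bounded {x. norm (x - x\<^sub>0) \<le> f x - t\<^sub>0}"
proof (rule ccontr)
  assume unb: "\<not> bounded {x. norm (x - x\<^sub>0) \<le> f x - t\<^sub>0}"
  have lip: "f x \<le> f y + norm (x - y)" for x y
    using Lipschitz_strict[of x y] by (cases "x = y") auto
  define C where "C m = sphere 0 1 \<inter> {\<theta>. t\<^sub>0 + real m \<le> f (x\<^sub>0 + real m *\<^sub>R \<theta>)}" for m :: nat
  have slide: "f (x\<^sub>0 + b *\<^sub>R \<theta>) - (b - a) \<le> f (x\<^sub>0 + a *\<^sub>R \<theta>)" if "norm \<theta> = 1" "a \<le> b" for \<theta> a b
  proof -
    have "x\<^sub>0 + b *\<^sub>R \<theta> - (x\<^sub>0 + a *\<^sub>R \<theta>) = (b - a) *\<^sub>R \<theta>" by (simp add: algebra_simps)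
    then show ?thesis
      using lip[of "x\<^sub>0 + b *\<^sub>R \<theta>" "x\<^sub>0 + a *\<^sub>R \<theta>"] that by simp
  qed
  have "\<Inter>(range C) \<noteq> {}"
  proof (rule compact_nest)
    show "compact (C m)" for m
      unfolding C_def
      by (intro compact_Int_closed compact_sphere closed_Collect_le continuous_intros
          continuous_on_compose2[OF continuous_f]) auto
    show "C m \<noteq> {}" for m
    proof -
      obtain x where x: "norm (x - x\<^sub>0) \<le> f x - t\<^sub>0" "real m + 1 < norm (x - x\<^sub>0)"
      proof -
        have "\<exists>x\<in>{x. norm (x - x\<^sub>0) \<le> f x - t\<^sub>0}. \<not> norm x \<le> real m + 1 + norm x\<^sub>0"
          using unb unfolding bounded_iff by blast
        then obtain x where "norm (x - x\<^sub>0) \<le> f x - t\<^sub>0" "real m + 1 + norm x\<^sub>0 < norm x" by force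
        then show ?thesis using that[of x] norm_triangle_sub[of x x\<^sub>0] by linarith
      qed
      define R where "R = norm (x - x\<^sub>0)"
      define \<theta> where "\<theta> = (1 / R) *\<^sub>R (x - x\<^sub>0)"
      have R: "R > 0" "real m \<le> R" using x by (auto simp: R_def)
      have \<theta>: "norm \<theta> = 1" using R(1) by (simp add: \<theta>_def R_def)
      have "x\<^sub>0 + R *\<^sub>R \<theta> = x" using R(1) by (simp add: \<theta>_def)
      then have "t\<^sub>0 + real m \<le> f (x\<^sub>0 + real m *\<^sub>R \<theta>)"
        using slide[OF \<theta> R(2)] x(1) by (simp add: R_def)
      then have "\<theta> \<in> C m" using \<theta> by (simp add: C_def)
      then show ?thesis by blast
    qed
    show "C k \<subseteq> C m" if "m \<le> k" for m k
    proof
      fix \<theta> assume \<theta>: "\<theta> \<in> C k"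
      then show "\<theta> \<in> C m" using slide[of \<theta> "real m" "real k"] that by (simp add: C_def)
    qed
  qed
  then obtain \<theta> where \<theta>: "\<And>m. \<theta> \<in> C m" by auto
  then have n: "norm \<theta> = 1" by (simp add: C_def)
  have above: "t\<^sub>0 + t < f (x\<^sub>0 + t *\<^sub>R \<theta>)" for t
  proof -
    obtain m :: nat where m: "t < real m" using reals_Archimedean2 by blast
    have e: "x\<^sub>0 + real m *\<^sub>R \<theta> - (x\<^sub>0 + t *\<^sub>R \<theta>) = (real m - t) *\<^sub>R \<theta>" by (simp add: algebra_simps)
    have "x\<^sub>0 + real m *\<^sub>R \<theta> \<noteq> x\<^sub>0 + t *\<^sub>R \<theta>" using m n by auto
    from Lipschitz_strict[OF this] have "f (x\<^sub>0 + real m *\<^sub>R \<theta>) - f (x\<^sub>0 + t *\<^sub>R \<theta>) < real m - t"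
      unfolding e using m n by simp
    moreover have "t\<^sub>0 + real m \<le> f (x\<^sub>0 + real m *\<^sub>R \<theta>)" using \<theta>[of m] by (simp add: C_def)
    ultimately show ?thesis by linarith
  qed
  define \<gamma> where "\<gamma> t = x\<^sub>0 + max 0 (t - t\<^sub>0) *\<^sub>R \<theta>" for t
  have "1-lipschitz_on UNIV \<gamma>"
  proof (rule lipschitz_onI)
    fix s t :: real
    have "\<gamma> s - \<gamma> t = (max 0 (s - t\<^sub>0) - max 0 (t - t\<^sub>0)) *\<^sub>R \<theta>" by (simp add: \<gamma>_def algebra_simps)
    then show "dist (\<gamma> s) (\<gamma> t) \<le> 1 * dist s t" using n by (simp add: dist_norm)
  qed simp
  then have "inextendable_causal_curve {(\<gamma> t, t) | t. True}"
    unfolding inextendable_causal_curve_def by blast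
  moreover have "(x\<^sub>0, t\<^sub>0) \<in> {(\<gamma> t, t) | t. True}" by (auto simp: \<gamma>_def)
  ultimately have "{(\<gamma> t, t) | t. True} \<inter> S \<noteq> {}"
    using q unfolding domain_of_dependence_def by blast
  then obtain t where t: "t = f (\<gamma> t)" unfolding S_eq by auto
  show False
  proof (cases "t\<^sub>0 \<le> t")
    case True
    then have "f (\<gamma> t) > t" using above[of "t - t\<^sub>0"] by (simp add: \<gamma>_def)
    then show False using t by simp
  next
    case False
    then have "f (\<gamma> t) > t\<^sub>0" using above[of 0] by (simp add: \<gamma>_def)
    then show False using t False by simp
  qed
qed

lemma compact_future_part:
  assumes q: "q \<in> domain_of_dependence S"
  shows "compact {p \<in> S. 0 \<le> snd (p - q) \<and> mink (p - q) (p - q) \<le> 0}" (is "compact ?K")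
proof -
  obtain x\<^sub>0 t\<^sub>0 where q': "q = (x\<^sub>0, t\<^sub>0)" by (cases q)
  let ?B = "{x. norm (x - x\<^sub>0) \<le> f x - t\<^sub>0}"
  have "closed ?B"
    by (intro closed_Collect_le continuous_intros continuous_f)
  then have cB: "compact ?B" using bounded_future_part[of x\<^sub>0 t\<^sub>0] q q' by (simp add: compact_eq_bounded_closed)
  have m: "mink (x - x\<^sub>0, f x - t\<^sub>0) (x - x\<^sub>0, f x - t\<^sub>0) = (norm (x - x\<^sub>0))\<^sup>2 - (f x - t\<^sub>0)\<^sup>2" for x
    by (simp add: mink_def dot_square_norm power2_eq_square[of "f x - t\<^sub>0"])
  have iff: "norm (x - x\<^sub>0) \<le> f x - t\<^sub>0 \<longleftrightarrow> 0 \<le> f x - t\<^sub>0 \<and> (norm (x - x\<^sub>0))\<^sup>2 \<le> (f x - t\<^sub>0)\<^sup>2" for x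
    using abs_le_square_iff[of "norm (x - x\<^sub>0)" "f x - t\<^sub>0"] norm_ge_zero[of "x - x\<^sub>0"]
    by (cases "0 \<le> f x - t\<^sub>0") (simp, linarith)
  have "?K = (\<lambda>x. (x, f x)) ` ?B"
    unfolding iff S_eq q' by (auto simp: m)
  then show ?thesis
    using compact_continuous_image[OF _ cB, of "\<lambda>x. (x, f x)"] by (simp add: continuous_intros continuous_f)
qed

text \<open>The farthest point of the hypersurface from \<open>q\<close> lies before the first focal point, and focal
  points occur within proper time \<open>1 / H\<close>.\<close>

lemma focal_bound:
  assumes H: "H > 0" and mc: "\<And>p. p \<in> S \<Longrightarrow> H \<le> mean_curvature S p"
    and q: "q \<in> domain_of_dependence S" and p: "p \<in> S" "snd (p - q) > 0" "mink (p - q) (p - q) < 0"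
  shows "- mink (p - q) (p - q) \<le> 1 / H\<^sup>2"
proof -
  let ?K = "{p \<in> S. 0 \<le> snd (p - q) \<and> mink (p - q) (p - q) \<le> 0}"
  let ?F = "separation 0 0 0 0"
  have F: "?F p' q' = - mink (p' - q') (p' - q') / 2" for p' q' :: "'n minkowski" by (simp add: separation_def)
  have "continuous_on ?K (\<lambda>p. ?F p q)"
    unfolding F by (intro continuous_intros mink.continuous_on) auto
  then obtain p' where p': "p' \<in> ?K" "\<And>x. x \<in> ?K \<Longrightarrow> ?F x q \<le> ?F p' q"
    using continuous_attains_sup[OF compact_future_part[OF q], of "\<lambda>p. ?F p q"] p by fastforce
  define D where "D = p' - q"
  have pp': "- mink (p - q) (p - q) \<le> - mink D D" using p'(2)[of p] p by (simp add: F D_def)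
  then have D: "mink D D < 0" using p by simp
  have "snd D \<noteq> 0"
  proof
    assume "snd D = 0"
    then have "mink D D = fst D \<bullet> fst D" by (simp add: mink_def)
    then show False using D inner_ge_zero[of "fst D"] by linarith
  qed
  then have D0: "snd D > 0" using p' by (simp add: D_def)
  have p'S: "p' \<in> S" using p' by simp
  define W where "W = {x. 0 < snd (x - q)} \<inter> {x. mink (x - q) (x - q) < 0}"
  have W: "open W" "p' \<in> W"
    unfolding W_def using D D0
    by (auto simp: D_def intro!: open_Collect_less open_Int continuous_intros mink.continuous_on)
  obtain \<nu> h where \<nu>h: "second_form_at S p' \<nu> h"
    and tr: "\<And>e. mink_frame \<nu> e \<Longrightarrow> (\<Sum>i\<in>UNIV. h (e i)) = real CARD('n) * mean_curvature S p'"
    using second_fundamental_form[OF p'S] by metis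
  note \<nu> = second_form_atD[OF \<nu>h]
  have var: "mink D v = 0 \<and> (\<exists>a. mink a \<nu> = - h v \<and> - mink D a \<le> mink v v)" if v: "mink v \<nu> = 0" for v
  proof -
    obtain P P' a where P: "range P \<subseteq> S" "P 0 = p'" "\<And>s. (P has_vector_derivative P' s) (at s)" "P' 0 = v"
      "(P' has_vector_derivative a) (at 0)" "mink a \<nu> = - h v"
      using second_form_at_curve[OF \<nu>h v] by metis
    have "eventually (\<lambda>s. P s \<in> W) (nhds 0)"
      by (rule eventually_curve_in_open[OF P(3)]) (use W P in auto)
    then have "eventually (\<lambda>s. ?F (P s) q \<le> ?F (P 0) q) (nhds 0)"
    proof (rule eventually_mono)
      fix s assume "P s \<in> W"
      then have "P s \<in> ?K" using P(1) by (auto simp: W_def less_imp_le)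
      then show "?F (P s) q \<le> ?F (P 0) q" unfolding P(2) by (rule p'(2))
    qed
    note vary = separation_variation[OF P(3,5) has_vector_derivative_const has_vector_derivative_const this]
    show ?thesis
      by (intro conjI exI[of _ a])
        (use vary P in \<open>auto simp: D_def mink.zero_left mink.zero_right\<close>)
  qed
  define c where "c = - mink D \<nu>"
  have Dc: "D = c *\<^sub>R \<nu>"
    unfolding c_def using var by (intro orthogonal_to_hyperplane \<nu>) auto
  have "mink D \<nu> < 0" by (rule mink_future_timelike_neg) (use D D0 \<nu> in auto)
  then have c: "c > 0" by (simp add: c_def)
  have hv: "c * h v \<le> mink v v" if "mink v \<nu> = 0" for v
    using var[OF that] unfolding Dc by (auto simp: mink.scaleR_left mink_commute[of \<nu>])
  obtain e where e: "mink_frame \<nu> e" using mink_frame_exists[OF \<nu>(1,2)] by blast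
  have "c * (real CARD('n) * mean_curvature S p') = (\<Sum>i\<in>UNIV. c * h (e i))"
    by (simp add: tr[OF e, symmetric] sum_distrib_left)
  also have "\<dots> \<le> (\<Sum>i\<in>(UNIV::'n set). 1)"
    using hv e by (intro sum_mono) (metis mink_frame_def)
  finally have "c * mean_curvature S p' \<le> 1" by (simp add: mult.left_commute)
  moreover have "c * H \<le> c * mean_curvature S p'" using c mc[OF p'S] by (intro mult_left_mono) auto
  ultimately have "c * H \<le> 1" by linarith
  then have "(c * H)\<^sup>2 \<le> 1" using c H by (simp add: power_le_one)
  moreover have "- mink D D = c\<^sup>2" by (simp add: Dc mink.scaleR_left mink.scaleR_right \<nu> power2_eq_square)
  moreover have "c\<^sup>2 \<le> 1 / H\<^sup>2" using \<open>(c * H)\<^sup>2 \<le> 1\<close> H by (simp add: power_mult_distrib field_simps)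
  ultimately show ?thesis using pp' by linarith
qed

end

lemma compact_separation_domain:
  fixes p\<^sub>0 q\<^sub>0 N :: "'n::finite minkowski"
  assumes "closed S\<^sub>1" "closed S\<^sub>2" and N: "mink N N = -1"
  shows "compact {(p, q). p \<in> S\<^sub>1 \<and> q \<in> S\<^sub>2 \<and> 0 \<le> snd (p - q) \<and> mink (p - q) (p - q) \<le> 0 \<and>
    observer N (p - p\<^sub>0) (p - p\<^sub>0) + observer N (q - q\<^sub>0) (q - q\<^sub>0) \<le> d}" (is "compact ?K")
proof -
  let ?C = "1 + 2 * observer N (0, 1) (0, 1)"
  let ?o = "\<lambda>u. observer N u u"
  have C: "0 \<le> ?C" using observer_nonneg[OF N, of "(0, 1)"] by simp
  have "?K \<subseteq> cball p\<^sub>0 (sqrt (?C * d)) \<times> cball q\<^sub>0 (sqrt (?C * d))"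
  proof clarify
    fix p q assume "?o (p - p\<^sub>0) + ?o (q - q\<^sub>0) \<le> d"
    then have "?o (p - p\<^sub>0) \<le> d" "?o (q - q\<^sub>0) \<le> d"
      using observer_nonneg[OF N, of "p - p\<^sub>0"] observer_nonneg[OF N, of "q - q\<^sub>0"] by linarith+
    then have "(norm (p - p\<^sub>0))\<^sup>2 \<le> ?C * d" "(norm (q - q\<^sub>0))\<^sup>2 \<le> ?C * d"
      using norm_le_observer[OF N] mult_left_mono[OF _ C] order_trans by blast+
    then show "p \<in> cball p\<^sub>0 (sqrt (?C * d)) \<and> q \<in> cball q\<^sub>0 (sqrt (?C * d))"
      by (simp add: dist_norm norm_minus_commute real_le_rsqrt)
  qed
  then have "bounded ?K"
    by (rule bounded_subset[OF bounded_Times[OF bounded_cball bounded_cball]])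
  moreover have "?K = (S\<^sub>1 \<times> S\<^sub>2) \<inter> {z. 0 \<le> snd (fst z - snd z)} \<inter> {z. mink (fst z - snd z) (fst z - snd z) \<le> 0} \<inter>
      {z. ?o (fst z - p\<^sub>0) + ?o (snd z - q\<^sub>0) \<le> d}"
    by auto
  moreover have "closed \<dots>"
    by (intro closed_Int closed_Times assms closed_Collect_le continuous_intros mink.continuous_on observer.continuous_on)
  ultimately show ?thesis by (simp add: compact_eq_bounded_closed)
qed

lemma observer_reflect:
  assumes N: "mink N N = -1"
  shows "observer N (reflect N u) (reflect N v) = observer N u v"
proof -
  have "reflect N (reflect N v) = v"
    using N by (simp add: reflect_def mink.add_left mink.scaleR_left)
  then show ?thesis
    by (simp add: observer_def mink_commute[of "reflect N u"] observer_commute[of N v u, unfolded observer_def])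
qed

text \<open>The supremum \<open>M\<close> of the squared Lorentzian distance from \<open>S\<^sub>2\<close> up to \<open>S\<^sub>1\<close> is finite by the focal
  bound, but it need not be attained. The penalised separation, centred at a pair
  \<open>p\<^sub>0, q\<^sub>0\<close> that nearly attains it and measured by the observer who travels from \<open>q\<^sub>0\<close> to \<open>p\<^sub>0\<close>, has a
  maximum over nearby pairs; because the centre is nearly optimal, the maximum lies in the interior
  of the admissible region.\<close>

lemma comparison_graphs:
  fixes f\<^sub>1 f\<^sub>2 :: "real ^ 'n::finite \<Rightarrow> real"
  assumes g1: "spacelike_graph f\<^sub>1 S\<^sub>1" and g2: "spacelike_graph f\<^sub>2 S\<^sub>2" and H: "H > 0"
    and mc1: "\<And>p. p \<in> S\<^sub>1 \<Longrightarrow> H \<le> mean_curvature S\<^sub>1 p"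
    and mc2: "\<And>p. p \<in> S\<^sub>2 \<Longrightarrow> mean_curvature S\<^sub>2 p \<le> H"
    and dep: "S\<^sub>2 \<subseteq> domain_of_dependence S\<^sub>1"
  shows "f\<^sub>1 x \<le> f\<^sub>2 x"
proof (rule ccontr)
  assume not_le: "\<not> f\<^sub>1 x \<le> f\<^sub>2 x"
  interpret G1: spacelike_graph f\<^sub>1 S\<^sub>1 by (rule g1)
  interpret G2: spacelike_graph f\<^sub>2 S\<^sub>2 by (rule g2)
  define A where "A = {(p, q). p \<in> S\<^sub>1 \<and> q \<in> S\<^sub>2 \<and> 0 < snd (p - q) \<and> mink (p - q) (p - q) < 0}"
  define \<sigma> where "\<sigma> z = - mink (fst z - snd z) (fst z - snd z)" for z :: "'n minkowski \<times> 'n minkowski"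
  have bound: "\<sigma> z \<le> 1 / H\<^sup>2" if "z \<in> A" for z
    using G1.focal_bound[OF H mc1, of "snd z" "fst z"] that dep by (auto simp: A_def \<sigma>_def)
  have z0: "((x, f\<^sub>1 x), (x, f\<^sub>2 x)) \<in> A"
    using not_le by (auto simp: A_def G1.S_eq G2.S_eq mink_def mult_neg_neg)
  define M where "M = (SUP z\<in>A. \<sigma> z)"
  have bdd: "bdd_above (\<sigma> ` A)" using bound by (rule bdd_aboveI2)
  have \<sigma>M: "\<sigma> z \<le> M" if "z \<in> A" for z unfolding M_def by (rule cSUP_upper[OF that bdd])
  have "0 < \<sigma> ((x, f\<^sub>1 x), (x, f\<^sub>2 x))" using z0 by (simp add: A_def \<sigma>_def)
  then have M0: "0 < M" using \<sigma>M[OF z0] by linarith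
  have M1: "M \<le> 1 / H\<^sup>2" unfolding M_def by (rule cSUP_least) (use z0 bound in auto)
  define r where "r = sqrt M"
  have r0: "r > 0" and r2: "r\<^sup>2 = M" using M0 by (auto simp: r_def)
  have "r\<^sup>2 \<le> (1 / H)\<^sup>2" using M1 by (simp add: r2 power_divide)
  then have "r \<le> 1 / H" by (rule power2_le_imp_le) (use H in simp)
  then have rH: "r * H \<le> 1" using H by (simp add: field_simps)
  define \<kappa> y \<epsilon> \<delta> where "\<kappa> = r * H / 4" and "y = \<kappa> * r / 14" and "\<epsilon> = \<kappa>\<^sup>2 / 36" and "\<delta> = y / 3"
  have \<kappa>: "0 < \<kappa>" "\<kappa> \<le> 1 / 4" using r0 H rH by (auto simp: \<kappa>_def)
  have y: "0 < y" "56 * y \<le> r"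
    using \<kappa> r0 mult_right_mono[OF \<kappa>(2), of r] by (auto simp: y_def)
  have \<delta>: "0 < \<delta>" "9 * \<delta>\<^sup>2 = y\<^sup>2" using y by (auto simp: \<delta>_def power_divide)
  have "\<kappa>\<^sup>2 \<le> 1" using \<kappa> by (intro power_le_one) auto
  then have \<epsilon>: "0 < \<epsilon>" "\<epsilon> \<le> 1" using \<kappa> by (auto simp: \<epsilon>_def)
  \<comment> \<open>Within \<open>\<epsilon> * \<delta>\<^sup>2\<close> of the supremum the penalty confines the maximum to the interior of \<open>K\<close>; the
     second bound keeps the proper time \<open>s\<close> comparable to \<open>r\<close>.\<close>
  have "M - min (\<epsilon> * \<delta>\<^sup>2) (3 / 4 * M) < M" using \<epsilon> \<delta> M0 by simp
  then obtain z where z: "z \<in> A" "M - min (\<epsilon> * \<delta>\<^sup>2) (3 / 4 * M) < \<sigma> z"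
    unfolding M_def using less_cSUP_iff[OF _ bdd] z0 by blast
  obtain p\<^sub>0 q\<^sub>0 where pq: "z = (p\<^sub>0, q\<^sub>0)" by (cases z)
  define s where "s = sqrt (\<sigma> z)"
  have \<sigma>z: "M - \<epsilon> * \<delta>\<^sup>2 < \<sigma> z" "M / 4 < \<sigma> z" using z(2) by linarith+
  have s0: "s > 0" and s2: "s\<^sup>2 = \<sigma> z" using \<sigma>z M0 by (auto simp: s_def)
  have "(r / 2)\<^sup>2 \<le> s\<^sup>2" using \<sigma>z r2 s2 by (simp add: power_divide)
  then have rs: "r / 2 \<le> s" by (rule power2_le_imp_le) (use s0 in simp)
  define N where "N = (1 / s) *\<^sub>R (p\<^sub>0 - q\<^sub>0)"
  have sN: "p\<^sub>0 - q\<^sub>0 = s *\<^sub>R N" using s0 by (simp add: N_def)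
  have mD: "mink (p\<^sub>0 - q\<^sub>0) (p\<^sub>0 - q\<^sub>0) = - s\<^sup>2" by (simp add: s2 \<sigma>_def pq)
  then have "s\<^sup>2 * (mink N N + 1) = 0"
    unfolding sN by (simp add: mink.scaleR_left mink.scaleR_right power2_eq_square algebra_simps)
  then have N1: "mink N N = -1" using s0 by simp
  have N2: "snd N > 0" using z(1) s0 by (simp add: N_def A_def pq)
  have p0q0: "p\<^sub>0 \<in> S\<^sub>1" "q\<^sub>0 \<in> S\<^sub>2" "0 < snd (p\<^sub>0 - q\<^sub>0)" using z(1) by (auto simp: A_def pq)
  define X where "X p q = observer N (p - p\<^sub>0) (p - p\<^sub>0) + observer N (q - q\<^sub>0) (q - q\<^sub>0)" for p q
  let ?F = "separation N \<epsilon> p\<^sub>0 q\<^sub>0"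
  have F: "?F p q = \<sigma> (p, q) / 2 - \<epsilon> / 2 * X p q" for p q
    by (simp add: separation_def \<sigma>_def X_def)
  define K where "K = {(p, q). p \<in> S\<^sub>1 \<and> q \<in> S\<^sub>2 \<and> 0 \<le> snd (p - q) \<and> mink (p - q) (p - q) \<le> 0 \<and> X p q \<le> \<delta>\<^sup>2}"
  have "compact K"
    unfolding K_def X_def by (rule compact_separation_domain[OF G1.closed_S G2.closed_S N1])
  moreover have K0: "(p\<^sub>0, q\<^sub>0) \<in> K"
    using p0q0 mD by (simp add: K_def X_def observer.zero_left)
  moreover have "continuous_on K (\<lambda>z. ?F (fst z) (snd z))"
    unfolding separation_def
    by (intro continuous_intros mink.continuous_on observer.continuous_on) auto
  ultimately obtain w where w: "w \<in> K" "\<And>z. z \<in> K \<Longrightarrow> ?F (fst z) (snd z) \<le> ?F (fst w) (snd w)"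
    using continuous_attains_sup[of K "\<lambda>z. ?F (fst z) (snd z)"] by blast
  obtain p q where wpq: "w = (p, q)" by (cases w)
  have p: "p \<in> S\<^sub>1" and q: "q \<in> S\<^sub>2" and D: "0 \<le> snd (p - q)" using w(1) by (auto simp: K_def wpq)
  have X0: "0 \<le> X p q" unfolding X_def by (intro add_nonneg_nonneg observer_nonneg N1)
  have "?F p\<^sub>0 q\<^sub>0 \<le> ?F p q" using w(2)[OF K0] by (simp add: wpq)
  then have gain: "\<sigma> z + \<epsilon> * X p q \<le> \<sigma> (p, q)"
    by (simp add: F pq) (simp add: X_def observer.zero_left)
  moreover have "0 \<le> \<epsilon> * X p q" using \<epsilon> X0 by simp
  ultimately have neg: "mink (p - q) (p - q) < 0" using \<sigma>z M0 by (simp add: \<sigma>_def)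
  have "snd (p - q) \<noteq> 0"
  proof
    assume "snd (p - q) = 0"
    then have "mink (p - q) (p - q) = fst (p - q) \<bullet> fst (p - q)" by (simp add: mink_def)
    then show False using neg inner_ge_zero[of "fst (p - q)"] by linarith
  qed
  then have D0: "0 < snd (p - q)" using D by simp
  have "\<sigma> (p, q) \<le> M" by (rule \<sigma>M) (use p q D0 neg in \<open>simp add: A_def\<close>)
  then have "\<epsilon> * X p q < \<epsilon> * \<delta>\<^sup>2" using gain \<sigma>z by linarith
  then have X\<delta>: "X p q < \<delta>\<^sup>2" using \<epsilon> by simp
  define W where "W = {z. 0 < snd (fst z - snd z)} \<inter> {z. mink (fst z - snd z) (fst z - snd z) < 0} \<inter>
    {z. X (fst z) (snd z) < \<delta>\<^sup>2}"
  have W: "open W" "(p, q) \<in> W"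
    unfolding W_def X_def using D0 neg X\<delta>
    by (auto simp: X_def intro!: open_Int open_Collect_less continuous_intros mink.continuous_on observer.continuous_on)
  obtain \<nu>\<^sub>1 h\<^sub>1 where 1: "second_form_at S\<^sub>1 p \<nu>\<^sub>1 h\<^sub>1"
    and tr1: "\<And>e. mink_frame \<nu>\<^sub>1 e \<Longrightarrow> (\<Sum>i\<in>UNIV. h\<^sub>1 (e i)) = real CARD('n) * mean_curvature S\<^sub>1 p"
    using G1.second_fundamental_form[OF p] by metis
  obtain \<nu>\<^sub>2 h\<^sub>2 where 2: "second_form_at S\<^sub>2 q \<nu>\<^sub>2 h\<^sub>2"
    and tr2: "\<And>e. mink_frame \<nu>\<^sub>2 e \<Longrightarrow> (\<Sum>i\<in>UNIV. h\<^sub>2 (e i)) = real CARD('n) * mean_curvature S\<^sub>2 q"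
    using G2.second_fundamental_form[OF q] by metis
  note \<nu>\<^sub>1 = second_form_atD[OF 1] and \<nu>\<^sub>2 = second_form_atD[OF 2]
  have max: "?F p' q' \<le> ?F p q" if "p' \<in> S\<^sub>1" "q' \<in> S\<^sub>2" "(p', q') \<in> W" for p' q'
    using w(2)[of "(p', q')"] that by (simp add: K_def W_def wpq)
  obtain c\<^sub>1 c\<^sub>2 where V1: "p - q + \<epsilon> *\<^sub>R reflect N (p - p\<^sub>0) = c\<^sub>1 *\<^sub>R \<nu>\<^sub>1"
    and V2: "p - q - \<epsilon> *\<^sub>R reflect N (q - q\<^sub>0) = c\<^sub>2 *\<^sub>R \<nu>\<^sub>2"
    and le: "\<And>v w. mink v \<nu>\<^sub>1 = 0 \<Longrightarrow> mink w \<nu>\<^sub>2 = 0 \<Longrightarrow>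
       c\<^sub>1 * h\<^sub>1 v - c\<^sub>2 * h\<^sub>2 w \<le> mink (v - w) (v - w) + \<epsilon> * (observer N v v + observer N w w)"
    by (rule separation_maximum[OF 1 2 W max]; (assumption | (rule that; (assumption | blast))))
  have six: "6 * X p q \<le> y\<^sup>2"
    using X\<delta> X0 unfolding \<delta>(2)[symmetric] by linarith
  \<comment> \<open>Both gradients differ from \<open>p\<^sub>0 - q\<^sub>0\<close> by the displacements of \<open>p\<close> and \<open>q\<close> and a reflected multiple of
     one of them.\<close>
  have small: "observer N ((p - p\<^sub>0) + - (q - q\<^sub>0) + t *\<^sub>R reflect N u) ((p - p\<^sub>0) + - (q - q\<^sub>0) + t *\<^sub>R reflect N u) \<le> y\<^sup>2"
    if t: "\<bar>t\<bar> \<le> 1" and u: "observer N u u \<le> X p q" for t u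
  proof -
    have "t\<^sup>2 \<le> 1" using t by (simp add: abs_square_le_1)
    then have "t\<^sup>2 * observer N u u \<le> 1 * observer N u u"
      by (intro mult_right_mono observer_nonneg N1)
    then have refl_small: "observer N (t *\<^sub>R reflect N u) (t *\<^sub>R reflect N u) \<le> X p q"
      using u by (simp add: observer.scaleR_left observer.scaleR_right observer_reflect[OF N1] power2_eq_square mult.assoc)
    have "observer N ((p - p\<^sub>0) + - (q - q\<^sub>0) + t *\<^sub>R reflect N u) ((p - p\<^sub>0) + - (q - q\<^sub>0) + t *\<^sub>R reflect N u)
        \<le> 3 * (X p q + observer N (t *\<^sub>R reflect N u) (t *\<^sub>R reflect N u))"
      using observer_triple[OF N1, of "p - p\<^sub>0" "- (q - q\<^sub>0)" "t *\<^sub>R reflect N u"]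
      unfolding observer.minus_left observer.minus_right minus_minus X_def .
    also have "\<dots> \<le> 6 * X p q" using refl_small by simp
    also have "\<dots> \<le> y\<^sup>2" by (rule six)
    finally show ?thesis .
  qed
  have u1: "observer N (p - p\<^sub>0) (p - p\<^sub>0) \<le> X p q" "observer N (q - q\<^sub>0) (q - q\<^sub>0) \<le> X p q"
    unfolding X_def using observer_nonneg[OF N1] by simp_all
  have ys: "5 * y \<le> s" using y rs by linarith
  have e1: "s *\<^sub>R N + ((p - p\<^sub>0) + - (q - q\<^sub>0) + \<epsilon> *\<^sub>R reflect N (p - p\<^sub>0)) = c\<^sub>1 *\<^sub>R \<nu>\<^sub>1"
    unfolding V1[symmetric] sN[symmetric] by simp
  have e2: "s *\<^sub>R N + ((p - p\<^sub>0) + - (q - q\<^sub>0) + (- \<epsilon>) *\<^sub>R reflect N (q - q\<^sub>0)) = c\<^sub>2 *\<^sub>R \<nu>\<^sub>2"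
    unfolding V2[symmetric] sN[symmetric] by simp
  have t1: "\<bar>\<epsilon>\<bar> \<le> 1" "\<bar>- \<epsilon>\<bar> \<le> 1" using \<epsilon> by auto
  note near1 = near_timelike_multiple[OF N1 N2 \<nu>\<^sub>1(1,2) e1 small[OF t1(1) u1(1)] y(1) ys]
  note near2 = near_timelike_multiple[OF N1 N2 \<nu>\<^sub>2(1,2) e2 small[OF t1(2) u1(2)] y(1) ys]
  have "(1 + \<kappa>)\<^sup>2 * (c\<^sub>1 * mean_curvature S\<^sub>1 p) - c\<^sub>2 * mean_curvature S\<^sub>2 q \<le>
      (1 + \<kappa> - 1)\<^sup>2 + 7 * \<epsilon> * ((1 + \<kappa>)\<^sup>2 + 1)"
    by (rule traced_second_variation[OF 1 2 tr1 tr2 le N1 near1(3) near2(3)]) (use \<epsilon> \<kappa> in auto)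
  then show False
    using maximal_separation_numeric_contradiction[OF H r0 rH rs \<kappa>_def y_def near1(1) _ near2(2) mc1[OF p] mc2[OF q]]
      near2(1) ys y(1)
    by (simp add: \<epsilon>_def)
qed

theorem theorem2p8:
  fixes \<Sigma>\<^sub>1 \<Sigma>\<^sub>2 :: "'n::finite minkowski set" and H\<^sub>1 H\<^sub>2 :: real
  assumes "spacelike_hypersurface \<Sigma>\<^sub>1" and "entire \<Sigma>\<^sub>1"
    and "spacelike_hypersurface \<Sigma>\<^sub>2" and "entire \<Sigma>\<^sub>2"
    and "\<And>p. p \<in> \<Sigma>\<^sub>1 \<Longrightarrow> H\<^sub>1 \<le> mean_curvature \<Sigma>\<^sub>1 p" and "H\<^sub>1 > 0"
    and "\<And>p. p \<in> \<Sigma>\<^sub>2 \<Longrightarrow> mean_curvature \<Sigma>\<^sub>2 p \<le> H\<^sub>2"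
    and "H\<^sub>1 \<ge> H\<^sub>2"
    and "\<Sigma>\<^sub>2 \<subseteq> domain_of_dependence \<Sigma>\<^sub>1"
  shows "\<Sigma>\<^sub>1 \<subseteq> causal_past \<Sigma>\<^sub>2"
proof
  fix p assume p: "p \<in> \<Sigma>\<^sub>1"
  obtain f\<^sub>1 where g1: "spacelike_graph f\<^sub>1 \<Sigma>\<^sub>1" using spacelike_graph_entire[OF assms(1,2)] .
  obtain f\<^sub>2 where g2: "spacelike_graph f\<^sub>2 \<Sigma>\<^sub>2" using spacelike_graph_entire[OF assms(3,4)] .
  obtain x where x: "p = (x, f\<^sub>1 x)" using p spacelike_graph.S_eq[OF g1] by blast
  have q: "(x, f\<^sub>2 x) \<in> \<Sigma>\<^sub>2" using spacelike_graph.S_eq[OF g2] by blast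
  have "mean_curvature \<Sigma>\<^sub>2 q \<le> H\<^sub>1" if "q \<in> \<Sigma>\<^sub>2" for q
    using assms(7)[OF that] assms(8) by simp
  then have le: "f\<^sub>1 x \<le> f\<^sub>2 x"
    using comparison_graphs[OF g1 g2 assms(6,5) _ assms(9)] by blast
  define v :: "'n minkowski" where "v = (0, f\<^sub>2 x - f\<^sub>1 x)"
  have "v = 0 \<or> future_directed v \<and> (timelike v \<or> null v)"
    using le by (auto simp: v_def zero_prod_def future_directed_def timelike_def mink_def mult_neg_neg)
  moreover have "p = (x, f\<^sub>2 x) - v" by (simp add: x v_def)
  ultimately show "p \<in> causal_past \<Sigma>\<^sub>2"
    unfolding causal_past_def using q by blast
qed

end
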